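(* Let $(I,\leqslant)$ be a finite partially ordered set with $|I|\geqslant 2$. For each $i\in I$, let $\Delta_i$ be a finite set with at least two elements, and let $(F,\Delta)$ be the generalised wreath product constructed from the symmetric groups $(\operatorname{Sym}(\Delta_i),\Delta_i)_{i\in I}$ (with their natural actions). Then $d(F)=|I|$.
   Context: For a group $G$, $d(G)$ denotes the minimum number of generators of $G$. Generalised wreath product. Maps are written on the right. Let $(I,\leqslant)$ be a finite partially ordered set; for each $i\in I$ let $\Delta_i$ be a non-empty set and let $G_i$ be a permutation group on $\Delta_i$ (acting on the right). For $i\in I$ put $A(i)=\{j\in I: j>i\}$. A subset $J\subseteq I$ is ancestral if $i>j$ and $j\in J$ imply $i\in J$; each $A(i)$ is ancestral. For $J\subseteq I$ put $\Delta_J=\prod_{j\in J}\Delta_j$ (a singleton if $J=\emptyset$) and $\Delta=\Delta_I$. Let $F_i$ be the set of all functions $\Delta_{A(i)}\to G_i$, let $F_J=\prod_{i\in J}F_i$ and $F=F_I$; elements of $F$ are written $f=(f_i)_{i\in I}$, and $f_J=(f_i)_{i\in J}$. For $J$ ancestral, $f\in F_J$ acts on $\delta=(\delta_i)_{i\in J}\in\Delta_J$ by $\delta f=\bigl(\delta_i\,((\delta_j)_{j\in A(i)}f_i)\bigr)_{i\in J}$, where $(\delta_j)_{j\in A(i)}f_i\in G_i$ is applied to $\delta_i$. The product $t=fh$ of $f,h\in F$ is given by $\omega t_i=(\omega f_i)\bigl((\omega f_{A(i)})h_i\bigr)$ for $i\in I$, $\omega\in\Delta_{A(i)}$, where $f_{A(i)}\in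 F_{A(i)}$ acts on $\Delta_{A(i)}$ as just described. With this product $F$ is a group acting faithfully on $\Delta$; $(F,\Delta)$ is called the generalised wreath product constructed from $(G_i,\Delta_i)_{i\in I}$. *)

theory Defs
  imports "HOL-Algebra.Generated_Groups" "HOL-Combinatorics.Permutations"
    "HOL-Library.FuncSet" "HOL-Library.Extended_Nat"
begin

text \<open>The value is \<open>\<infinity>\<close> if \<open>G\<close> is not finitely generated.\<close>

definition min_generators :: "('a, 'b) monoid_scheme \<Rightarrow> enat" where
  "min_generators G =
     (INF S \<in> {S. S \<subseteq> carrier G \<and> finite S \<and> generate G S = carrier G}. enat (card S))"

text \<open>
  A partial order on the index set \<open>I\<close> is a relation \<open>r\<close> with \<open>partial_order_on I r\<close>;
  \<open>(i, j) \<in> r\<close> means \<open>i \<le> j\<close>.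
  The product of the \<open>\<Delta> j\<close> over \<open>j \<in> J\<close> is the set \<open>PiE J \<Delta>\<close> of extensional functions.
  A permutation group on a set \<open>X\<close> is a set of functions that permute \<open>X\<close> in the sense of
  \<open>permutes\<close>, that is, they are bijections of \<open>X\<close> and are the identity outside \<open>X\<close>.
\<close>

definition permutation_group_on :: "'a set \<Rightarrow> ('a \<Rightarrow> 'a) set \<Rightarrow> bool" where
  "permutation_group_on X P \<longleftrightarrow>
     (\<forall>p\<in>P. p permutes X) \<and> id \<in> P \<and>
     (\<forall>p\<in>P. \<forall>q\<in>P. q \<circ> p \<in> P) \<and> (\<forall>p\<in>P. Hilbert_Choice.inv p \<in> P)"

definition Sym_on :: "'a set \<Rightarrow> ('a \<Rightarrow> 'a) set" where
  "Sym_on X = {p. p permutes X}"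

definition above :: "'i set \<Rightarrow> 'i rel \<Rightarrow> 'i \<Rightarrow> 'i set" where
  "above I r i = {j \<in> I. (i, j) \<in> r \<and> j \<noteq> i}"

definition ancestral :: "'i set \<Rightarrow> 'i rel \<Rightarrow> 'i set \<Rightarrow> bool" where
  "ancestral I r J \<longleftrightarrow> J \<subseteq> I \<and> (\<forall>j\<in>J. above I r j \<subseteq> J)"

definition gwr_component ::
    "'i set \<Rightarrow> 'i rel \<Rightarrow> ('i \<Rightarrow> 'a set) \<Rightarrow> ('i \<Rightarrow> ('a \<Rightarrow> 'a) set) \<Rightarrow> 'i \<Rightarrow> (('i \<Rightarrow> 'a) \<Rightarrow> 'a \<Rightarrow> 'a) set"
  where "gwr_component I r \<Delta> G i = PiE (PiE (above I r i) \<Delta>) (\<lambda>_. G i)"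

text \<open>
  The action of the components of \<open>f\<close> with index in an ancestral set \<open>J\<close> on \<open>PiE J \<Delta>\<close>;
  \<open>gwr_act I r J f \<delta>\<close> is \<open>\<delta> f\<^sub>J\<close> in the notation with maps on the right.
\<close>

definition gwr_act ::
    "'i set \<Rightarrow> 'i rel \<Rightarrow> 'i set \<Rightarrow> ('i \<Rightarrow> ('i \<Rightarrow> 'a) \<Rightarrow> 'a \<Rightarrow> 'a) \<Rightarrow> ('i \<Rightarrow> 'a) \<Rightarrow> 'i \<Rightarrow> 'a" where
  "gwr_act I r J f \<delta> = (\<lambda>i\<in>J. f i (restrict \<delta> (above I r i)) (\<delta> i))"

text \<open>
  Maps act on the right, so that the product of two permutations \<open>p\<close> and \<open>q\<close>, in this order,
  is \<open>q \<circ> p\<close>.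
\<close>

definition gwr_mult ::
    "'i set \<Rightarrow> 'i rel \<Rightarrow> ('i \<Rightarrow> 'a set) \<Rightarrow> ('i \<Rightarrow> ('i \<Rightarrow> 'a) \<Rightarrow> 'a \<Rightarrow> 'a)
      \<Rightarrow> ('i \<Rightarrow> ('i \<Rightarrow> 'a) \<Rightarrow> 'a \<Rightarrow> 'a) \<Rightarrow> 'i \<Rightarrow> ('i \<Rightarrow> 'a) \<Rightarrow> 'a \<Rightarrow> 'a" where
  "gwr_mult I r \<Delta> f h =
     (\<lambda>i\<in>I. \<lambda>\<omega>\<in>PiE (above I r i) \<Delta>. h i (gwr_act I r (above I r i) f \<omega>) \<circ> f i \<omega>)"

definition generalised_wreath_product ::
    "'i set \<Rightarrow> 'i rel \<Rightarrow> ('i \<Rightarrow> 'a set) \<Rightarrow> ('i \<Rightarrow> ('a \<Rightarrow> 'a) set)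
      \<Rightarrow> ('i \<Rightarrow> ('i \<Rightarrow> 'a) \<Rightarrow> 'a \<Rightarrow> 'a) monoid" where
  "generalised_wreath_product I r \<Delta> G =
     \<lparr>carrier = PiE I (gwr_component I r \<Delta> G),
      monoid.mult = gwr_mult I r \<Delta>,
      one = (\<lambda>i\<in>I. \<lambda>\<omega>\<in>PiE (above I r i) \<Delta>. id)\<rparr>"

lemma above_trans:
  assumes "partial_order_on I r" "j \<in> above I r i"
  shows "above I r j \<subseteq> above I r i"
  using assms partial_order_onD[OF assms(1)] unfolding above_def trans_def antisym_def by blast

lemma ancestral_above: "partial_order_on I r \<Longrightarrow> ancestral I r (above I r i)"
  unfolding ancestral_def using above_trans by (metis (no_types, lifting) above_def mem_Collect_eq subsetI)

lemma ancestral_carrier: "ancestral I r I"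
  by (auto simp: ancestral_def above_def)

lemma Sym_on_permutation_group: "permutation_group_on X (Sym_on X)"
  by (auto simp: permutation_group_on_def Sym_on_def permutes_id permutes_compose permutes_inv)

context
  fixes I :: "'i set" and r :: "'i rel" and \<Delta> :: "'i \<Rightarrow> 'a set" and G :: "'i \<Rightarrow> ('a \<Rightarrow> 'a) set"
  assumes fin: "finite I" and po: "partial_order_on I r"
    and pg: "\<And>i. i \<in> I \<Longrightarrow> permutation_group_on (\<Delta> i) (G i)"
begin

abbreviation (input) "W \<equiv> generalised_wreath_product I r \<Delta> G"

lemma gwr_value_in:
  assumes "f \<in> carrier W" "i \<in> I" "\<omega> \<in> PiE (above I r i) \<Delta>"
  shows "f i \<omega> \<in> G i" "f i \<omega> permutes \<Delta> i"
proof -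
  show "f i \<omega> \<in> G i"
    using assms PiE_mem[of f I "gwr_component I r \<Delta> G" i]
      PiE_mem[of "f i" "PiE (above I r i) \<Delta>" "\<lambda>_. G i" \<omega>]
    by (simp add: generalised_wreath_product_def gwr_component_def)
  then show "f i \<omega> permutes \<Delta> i"
    using pg[OF assms(2)] by (auto simp: permutation_group_on_def)
qed

lemma restrict_PiE_above:
  assumes "ancestral I r J" "\<delta> \<in> PiE J \<Delta>" "i \<in> J"
  shows "restrict \<delta> (above I r i) \<in> PiE (above I r i) \<Delta>"
  using assms by (auto simp: ancestral_def intro!: restrict_PiE_iff[THEN iffD2])

lemma gwr_act_in:
  assumes "f \<in> carrier W" "ancestral I r J" "\<delta> \<in> PiE J \<Delta>"
  shows "gwr_act I r J f \<delta> \<in> PiE J \<Delta>"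
proof -
  have "f i (restrict \<delta> (above I r i)) (\<delta> i) \<in> \<Delta> i" if "i \<in> J" for i
  proof -
    have i: "i \<in> I" using assms(2) that by (auto simp: ancestral_def)
    show ?thesis
      using gwr_value_in(2)[OF assms(1) i restrict_PiE_above[OF assms(2,3) that]]
        permutes_in_image PiE_mem[OF assms(3) that] by fastforce
  qed
  then show ?thesis by (simp add: gwr_act_def restrict_PiE_iff)
qed

lemma restrict_gwr_act:
  assumes "K \<subseteq> J" "\<And>i. i \<in> K \<Longrightarrow> above I r i \<subseteq> K"
  shows "restrict (gwr_act I r J f \<delta>) K = gwr_act I r K f (restrict \<delta> K)"
  using assms by (auto simp: gwr_act_def fun_eq_iff Int_absorb1 Int_absorb2)

lemma gwr_act_mult:
  assumes "ancestral I r J" "\<delta> \<in> PiE J \<Delta>"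
  shows "gwr_act I r J (f \<otimes>\<^bsub>W\<^esub> h) \<delta> = gwr_act I r J h (gwr_act I r J f \<delta>)"
proof
  fix i
  show "gwr_act I r J (f \<otimes>\<^bsub>W\<^esub> h) \<delta> i = gwr_act I r J h (gwr_act I r J f \<delta>) i"
  proof (cases "i \<in> J")
    case True
    have "restrict (gwr_act I r J f \<delta>) (above I r i)
        = gwr_act I r (above I r i) f (restrict \<delta> (above I r i))"
      using True assms(1) above_trans[OF po] by (intro restrict_gwr_act) (auto simp: ancestral_def)
    moreover have "i \<in> I" using True assms(1) by (auto simp: ancestral_def)
    ultimately show ?thesis
      using True restrict_PiE_above[OF assms True]
      by (simp add: gwr_act_def[of _ _ J] generalised_wreath_product_def gwr_mult_def)
  qed (simp add: gwr_act_def)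
qed

lemma gwr_act_one:
  assumes "ancestral I r J" "\<delta> \<in> PiE J \<Delta>"
  shows "gwr_act I r J \<one>\<^bsub>W\<^esub> \<delta> = \<delta>"
proof
  fix i
  show "gwr_act I r J \<one>\<^bsub>W\<^esub> \<delta> i = \<delta> i"
  proof (cases "i \<in> J")
    case True
    moreover have "i \<in> I" using True assms(1) by (auto simp: ancestral_def)
    ultimately show ?thesis
      using restrict_PiE_above[OF assms True]
      by (simp add: gwr_act_def generalised_wreath_product_def)
  next
    case False
    then show ?thesis using PiE_arb[OF assms(2)] by (simp add: gwr_act_def)
  qed
qed

lemma wf_above: "wf {(j, i). i \<in> I \<and> j \<in> above I r i}"
proof (rule finite_acyclic_wf)
  show "finite {(j, i). i \<in> I \<and> j \<in> above I r i}"
    by (rule finite_subset[of _ "I \<times> I"]) (auto simp: above_def fin)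
  have "{(j, i). i \<in> I \<and> j \<in> above I r i} \<subseteq> (r - Id)\<inverse>"
    by (auto simp: above_def)
  then show "acyclic {(j, i). i \<in> I \<and> j \<in> above I r i}"
    using partial_order_on_acyclic[OF po] acyclic_subset by (metis acyclic_converse)
qed

lemma gwr_act_inj:
  assumes "f \<in> carrier W" "ancestral I r J"
  shows "inj_on (gwr_act I r J f) (PiE J \<Delta>)"
proof (rule inj_onI)
  fix \<delta> \<epsilon> assume d: "\<delta> \<in> PiE J \<Delta>" and e: "\<epsilon> \<in> PiE J \<Delta>"
    and eq: "gwr_act I r J f \<delta> = gwr_act I r J f \<epsilon>"
  have "i \<in> J \<longrightarrow> \<delta> i = \<epsilon> i" for i
  proof (induction i rule: wf_induct_rule[OF wf_above])
    case (1 i)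
    show ?case
    proof
      assume i: "i \<in> J"
      then have iI: "i \<in> I" and sub: "above I r i \<subseteq> J"
        using assms(2) by (auto simp: ancestral_def)
      have res: "restrict \<delta> (above I r i) = restrict \<epsilon> (above I r i)"
        using 1 iI sub by (intro restrict_ext) auto
      have "f i (restrict \<delta> (above I r i)) (\<delta> i) = f i (restrict \<delta> (above I r i)) (\<epsilon> i)"
        using fun_cong[OF eq, of i] i res by (simp add: gwr_act_def)
      then show "\<delta> i = \<epsilon> i"
        using permutes_inj[OF gwr_value_in(2)[OF assms(1) iI restrict_PiE_above[OF assms(2) d i]]]
        by (simp add: inj_eq)
    qed
  qed
  then show "\<delta> = \<epsilon>" using d e by (auto intro: PiE_ext)
qed

lemma gwr_mult_closed:
  assumes f: "f \<in> carrier W" and h: "h \<in> carrier W"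
  shows "f \<otimes>\<^bsub>W\<^esub> h \<in> carrier W"
proof -
  have "h i (gwr_act I r (above I r i) f \<omega>) \<circ> f i \<omega> \<in> G i"
    if "i \<in> I" "\<omega> \<in> PiE (above I r i) \<Delta>" for i \<omega>
    using gwr_value_in(1)[OF f that] gwr_value_in(1)[OF h that(1) gwr_act_in[OF f ancestral_above[OF po] that(2)]]
      pg[OF that(1)] by (auto simp: permutation_group_on_def)
  then show ?thesis
    by (simp add: generalised_wreath_product_def gwr_component_def gwr_mult_def restrict_PiE_iff)
qed

lemma gwr_one_closed: "\<one>\<^bsub>W\<^esub> \<in> carrier W"
  using pg by (simp add: generalised_wreath_product_def gwr_component_def restrict_PiE_iff
      permutation_group_on_def)

lemma gwr_eqI:
  assumes "f \<in> carrier W" "h \<in> carrier W"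
    and "\<And>i \<omega>. i \<in> I \<Longrightarrow> \<omega> \<in> PiE (above I r i) \<Delta> \<Longrightarrow> f i \<omega> = h i \<omega>"
  shows "f = h"
proof (rule PiE_ext)
  show f: "f \<in> PiE I (gwr_component I r \<Delta> G)" and h: "h \<in> PiE I (gwr_component I r \<Delta> G)"
    using assms by (simp_all add: generalised_wreath_product_def)
  fix i assume i: "i \<in> I"
  show "f i = h i"
    using PiE_mem[OF f i] PiE_mem[OF h i] assms(3)[OF i]
    unfolding gwr_component_def by (rule PiE_ext)
qed

lemma gwr_mult_apply:
  assumes "i \<in> I" "\<omega> \<in> PiE (above I r i) \<Delta>"
  shows "(f \<otimes>\<^bsub>W\<^esub> h) i \<omega> = h i (gwr_act I r (above I r i) f \<omega>) \<circ> f i \<omega>"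
  using assms by (simp add: generalised_wreath_product_def gwr_mult_def)

lemma gwr_one_apply:
  assumes "i \<in> I" "\<omega> \<in> PiE (above I r i) \<Delta>"
  shows "\<one>\<^bsub>W\<^esub> i \<omega> = id"
  using assms by (simp add: generalised_wreath_product_def)

lemma generalised_wreath_product_group: "group W"
proof -
  note anc = ancestral_above[OF po]
  have mon: "monoid W"
  proof (rule monoidI)
    fix f g h assume f: "f \<in> carrier W" and g: "g \<in> carrier W" and h: "h \<in> carrier W"
    show "f \<otimes>\<^bsub>W\<^esub> g \<otimes>\<^bsub>W\<^esub> h = f \<otimes>\<^bsub>W\<^esub> (g \<otimes>\<^bsub>W\<^esub> h)"
      using f g h
      by (intro gwr_eqI gwr_mult_closed)
        (auto simp: gwr_mult_apply gwr_act_mult[OF anc] gwr_act_in[OF f anc] o_assoc)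
  next
    fix f assume f: "f \<in> carrier W"
    show "\<one>\<^bsub>W\<^esub> \<otimes>\<^bsub>W\<^esub> f = f" "f \<otimes>\<^bsub>W\<^esub> \<one>\<^bsub>W\<^esub> = f"
      using f gwr_act_in[OF f anc]
      by (auto intro!: gwr_eqI gwr_mult_closed gwr_one_closed
          simp: gwr_mult_apply gwr_act_one[OF anc] gwr_one_apply)
  qed (use gwr_mult_closed gwr_one_closed in auto)
  have rinv: "\<exists>h\<in>carrier W. f \<otimes>\<^bsub>W\<^esub> h = \<one>\<^bsub>W\<^esub>" if f: "f \<in> carrier W" for f
  proof
    define \<phi> where "\<phi> i = gwr_act I r (above I r i) f" for i
    define h where "h = (\<lambda>i\<in>I. \<lambda>\<omega>\<in>PiE (above I r i) \<Delta>.
      if \<omega> \<in> \<phi> i ` PiE (above I r i) \<Delta>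
      then Hilbert_Choice.inv (f i (inv_into (PiE (above I r i) \<Delta>) (\<phi> i) \<omega>)) else id)"
    have "(if \<omega> \<in> \<phi> i ` PiE (above I r i) \<Delta>
        then Hilbert_Choice.inv (f i (inv_into (PiE (above I r i) \<Delta>) (\<phi> i) \<omega>)) else id) \<in> G i"
      if "i \<in> I" for i \<omega>
      using gwr_value_in(1)[OF f that] pg[OF that] inv_into_into[of \<omega> "\<phi> i"]
      by (auto simp: permutation_group_on_def)
    then show hW: "h \<in> carrier W"
      unfolding h_def by (simp add: generalised_wreath_product_def gwr_component_def restrict_PiE_iff)
    show "f \<otimes>\<^bsub>W\<^esub> h = \<one>\<^bsub>W\<^esub>"
    proof (rule gwr_eqI[OF gwr_mult_closed[OF f hW] gwr_one_closed])
      fix i \<omega> assume i: "i \<in> I" and w: "\<omega> \<in> PiE (above I r i) \<Delta>"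
      have "h i (\<phi> i \<omega>) = Hilbert_Choice.inv (f i \<omega>)"
        using i w gwr_act_in[OF f anc w] inv_into_f_f[OF gwr_act_inj[OF f anc] w]
        by (simp add: h_def \<phi>_def)
      then show "(f \<otimes>\<^bsub>W\<^esub> h) i \<omega> = \<one>\<^bsub>W\<^esub> i \<omega>"
        using permutes_inv_o(2)[OF gwr_value_in(2)[OF f i w]]
        by (simp add: gwr_mult_apply[OF i w] gwr_one_apply[OF i w] \<phi>_def)
    qed
  qed
  interpret monoid W by (fact mon)
  show ?thesis
  proof (rule group_l_invI)
    fix f assume f: "f \<in> carrier W"
    obtain h where h: "h \<in> carrier W" "f \<otimes>\<^bsub>W\<^esub> h = \<one>\<^bsub>W\<^esub>" using rinv[OF f] by blast
    obtain k where k: "k \<in> carrier W" "h \<otimes>\<^bsub>W\<^esub> k = \<one>\<^bsub>W\<^esub>" using rinv[OF h(1)] by blast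
    have "f = k" using f h k by (metis m_assoc l_one r_one)
    then show "\<exists>h\<in>carrier W. h \<otimes>\<^bsub>W\<^esub> f = \<one>\<^bsub>W\<^esub>" using h k by blast
  qed
qed

lemma gwr_act_faithful:
  assumes ne: "\<And>i. i \<in> I \<Longrightarrow> \<Delta> i \<noteq> {}"
    and f: "f \<in> carrier W" and h: "h \<in> carrier W"
    and eq: "\<And>\<delta>. \<delta> \<in> PiE I \<Delta> \<Longrightarrow> gwr_act I r I f \<delta> = gwr_act I r I h \<delta>"
  shows "f = h"
proof (rule gwr_eqI[OF f h])
  fix i \<omega> assume i: "i \<in> I" and w: "\<omega> \<in> PiE (above I r i) \<Delta>"
  show "f i \<omega> = h i \<omega>"
  proof
    fix x
    show "f i \<omega> x = h i \<omega> x"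
    proof (cases "x \<in> \<Delta> i")
      case True
      have "\<forall>j\<in>I. \<exists>x. x \<in> \<Delta> j" using ne by auto
      then obtain c where c: "\<And>j. j \<in> I \<Longrightarrow> c j \<in> \<Delta> j"
        using bchoice by metis
      define \<delta> where "\<delta> = (\<lambda>j\<in>I. if j \<in> above I r i then \<omega> j else if j = i then x else c j)"
      have d: "\<delta> \<in> PiE I \<Delta>"
        using True PiE_mem[OF w] c by (simp add: \<delta>_def restrict_PiE_iff)
      have "restrict \<delta> (above I r i) = \<omega>"
        by (rule PiE_ext[OF restrict_PiE_above[OF ancestral_carrier d i] w])
          (auto simp: \<delta>_def above_def)
      moreover have "\<delta> i = x" using i by (simp add: \<delta>_def above_def)
      ultimately show ?thesis
        using fun_cong[OF eq[OF d], of i] i by (simp add: gwr_act_def)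
    next
      case False
      then show ?thesis
        using gwr_value_in(2)[OF f i w] gwr_value_in(2)[OF h i w] by (simp add: permutes_not_in)
    qed
  qed
qed

end

end

theory Submission
  imports Defs "HOL-Combinatorics.Cycles"
begin

text \<open>
  Lower bound. For each index \<open>i\<close>, multiplying the signs of the values of the component \<open>f i\<close> is a
  homomorphism to \<open>{1, -1}\<close>, and these characters are independent. So \<open>F\<close> maps onto an elementary
  abelian 2-group of rank \<open>card I\<close>, which needs \<open>card I\<close> generators (\<open>card_le_generators\<close>).

  Upper bound. The components with index in an ancestral set \<open>J\<close> form a group \<open>U J\<close>, and the
  bound is proved for all ancestral \<open>J\<close> with at least two elements, by adding one minimal index at
  a time.

  Adding an index \<open>i\<close> below \<open>J\<close> (\<open>generated_insert\<close>): \<open>U (insert i J)\<close> is the extension of \<open>U J\<close> by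
  the layer of all functions from \<open>\<Omega> i\<close>, the product of the \<open>\<Delta> j\<close> over \<open>j > i\<close>, to the
  symmetric group on \<open>\<Delta> i\<close>. The new generator is a transposition placed at a single point of
  \<open>\<Omega> i\<close>, and one old generator \<open>x\<close> is multiplied by a permutation \<open>s\<close> placed at the same point.
  Following the transposition around its cycle under \<open>x\<close> conjugates it by \<open>s\<close>; a suitable \<open>s\<close> gives
  the whole symmetric group at that point, and transitivity on \<open>\<Omega> i\<close> carries it to the whole layer
  (\<open>layer_from_point\<close>). This step needs at least one old generator to carry \<open>s\<close> and otherwise costs
  exactly one.

  It cannot start from one index, since a symmetric group may need two generators. The start is
  therefore \<open>card J = 2\<close> (\<open>generated_pair\<close>). There each of the two generators has to do two things at
  once. The device is that a product of a transposition and a commuting element of odd order has both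
  factors among its powers, and that a symmetric group is generated by a transposition and an
  element of odd order (\<open>odd_order_and_transposition_generate\<close>). For incomparable indices this
  finishes the proof. For a chain with top degree at least 3, one generator is the product of a
  transposition of the top group and an odd-order element at a point which that transposition fixes;
  the other is a full cycle of the top group times a transposition at one point. For a chain with top
  group of order 2, the step above applies to the single generator of the top group.
\<close>

section \<open>Generating a symmetric group by conjugate transpositions\<close>

lemma conj_transpose:
  assumes "bij s"
  shows "s \<circ> transpose a b \<circ> Hilbert_Choice.inv s = transpose (s a) (s b)"
proof -
  have "transpose (s a) (s b) \<circ> s = s \<circ> transpose a b"
    using transpose_comp_eq[OF assms, of "s a" "s b"] assms by (simp add: bij_is_inj)
  then show ?thesis
    using assms by (metis bij_is_surj comp_assoc comp_id surj_iff)
qed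

lemma star_transpositions_generate:
  assumes fin: "finite X" and id: "id \<in> P" and comp: "\<And>p q. p \<in> P \<Longrightarrow> q \<in> P \<Longrightarrow> p \<circ> q \<in> P"
    and star: "\<And>x. x \<in> X \<Longrightarrow> transpose c x \<in> P" and p: "p permutes X"
  shows "p \<in> P"
  using p fin
proof (induction rule: permutes_induct)
  case (swap a b p)
  have "transpose a b \<in> P"
  proof (cases "a = c \<or> b = c")
    case True
    then show ?thesis using star swap(1,2) by (metis transpose_commute)
  next
    case False
    then have "transpose a b = transpose a c \<circ> transpose c b \<circ> transpose a c"
      using swap(3) transpose_comp_triple[of a b c] by metis
    then show ?thesis using comp star swap(1,2) by (metis transpose_commute)
  qed
  then show ?case using comp swap by blast
qed (rule id)

lemma adjacent_transpositions_generate: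
  assumes id: "id \<in> P" and comp: "\<And>p q. p \<in> P \<Longrightarrow> q \<in> P \<Longrightarrow> p \<circ> q \<in> P"
    and adj: "\<And>j. Suc j < length xs \<Longrightarrow> transpose (xs ! j) (xs ! Suc j) \<in> P"
    and dist: "distinct xs" and p: "p permutes set xs"
  shows "p \<in> P"
proof -
  have path: "j < length xs \<Longrightarrow> transpose (xs ! 0) (xs ! j) \<in> P" for j
  proof (induction j)
    case (Suc j)
    show ?case
    proof (cases "j = 0")
      case False
      have "transpose (xs ! 0) (xs ! Suc j)
          = transpose (xs ! 0) (xs ! j) \<circ> transpose (xs ! j) (xs ! Suc j) \<circ> transpose (xs ! 0) (xs ! j)"
        using Suc.prems False dist
        by (intro transpose_comp_triple[symmetric]) (metis nth_eq_iff_index_eq Suc_lessD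
            less_trans zero_less_Suc nat.distinct(1) n_not_Suc_n)+
      then show ?thesis using Suc comp adj by (metis Suc_lessD)
    qed (use adj Suc in auto)
  qed (simp add: id)
  show ?thesis
    by (rule star_transpositions_generate[OF finite_set id comp _ p, of "xs ! 0"])
      (auto simp: in_set_conv_nth path)
qed

lemma cycle_of_list_nth:
  assumes "distinct xs" "j < length xs"
  shows "cycle_of_list xs (xs ! j) = xs ! (Suc j mod length xs)"
proof -
  have "map (cycle_of_list xs) xs ! j = rotate 1 xs ! j"
    using cyclic_rotation[OF assms(1), of 1] by simp
  then show ?thesis using assms(2) nth_rotate[of j xs 1] by simp
qed

lemma cycle_of_list_funpow_length:
  assumes "distinct xs"
  shows "cycle_of_list xs ^^ length xs = id"
proof
  fix x
  show "(cycle_of_list xs ^^ length xs) x = id x"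
  proof (cases "x \<in> set xs")
    case True
    then show ?thesis
      using cyclic_rotation[OF assms, of "length xs"] by (auto simp: map_eq_conv[where g = id, simplified])
  next
    case False
    then show ?thesis
      using permutes_not_in[OF permutes_funpow[OF cycle_permutes]] by simp
  qed
qed

text \<open>
  The hypothesis on \<open>P\<close> is stability under conjugation by \<open>s\<close> rather than \<open>s \<in> P\<close>, because in the
  induction over the index set \<open>s\<close> occurs as a value of group elements that also act elsewhere.
\<close>

definition Sym_from_conjugates :: "'a set \<Rightarrow> 'a \<Rightarrow> 'a \<Rightarrow> ('a \<Rightarrow> 'a) \<Rightarrow> bool" where
  "Sym_from_conjugates X a b s \<longleftrightarrow>
    (\<forall>P. id \<in> P \<longrightarrow> (\<forall>p\<in>P. \<forall>q\<in>P. p \<circ> q \<in> P) \<longrightarrow> transpose a b \<in> P \<longrightarrow>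
      (\<forall>p\<in>P. s \<circ> p \<circ> Hilbert_Choice.inv s \<in> P) \<longrightarrow> Sym_on X \<subseteq> P)"

lemma Sym_from_conjugatesI:
  assumes "\<And>P p. \<lbrakk>id \<in> P; \<And>p q. p \<in> P \<Longrightarrow> q \<in> P \<Longrightarrow> p \<circ> q \<in> P; transpose a b \<in> P;
    \<And>p. p \<in> P \<Longrightarrow> s \<circ> p \<circ> Hilbert_Choice.inv s \<in> P; p permutes X\<rbrakk> \<Longrightarrow> p \<in> P"
  shows "Sym_from_conjugates X a b s"
  unfolding Sym_from_conjugates_def Sym_on_def using assms by blast

lemma Sym_from_conjugatesD:
  assumes "Sym_from_conjugates X a b s" "id \<in> P" "\<And>p q. p \<in> P \<Longrightarrow> q \<in> P \<Longrightarrow> p \<circ> q \<in> P"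
    "transpose a b \<in> P" "\<And>p. p \<in> P \<Longrightarrow> s \<circ> p \<circ> Hilbert_Choice.inv s \<in> P" "p permutes X"
  shows "p \<in> P"
  using assms unfolding Sym_from_conjugates_def Sym_on_def by blast

text \<open>
  On a set of \<open>m\<close> points, \<open>s\<close> is a cycle on all of them if \<open>m\<close> is odd and on all but \<open>a\<close> if \<open>m\<close>
  is even; the conjugates of \<open>(a b)\<close> under the powers of \<open>s\<close> then contain a path or a star on all
  points.
\<close>

lemma odd_order_and_transposition_generate:
  assumes "finite X" "2 \<le> card X"
  obtains a b s L where "a \<in> X" "b \<in> X" "a \<noteq> b" "s permutes X" "odd L" "s ^^ L = id"
    "Sym_from_conjugates X a b s"
proof -
  obtain xs where xs: "set xs = X" "distinct xs" using finite_distinct_list[OF assms(1)] by blast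
  then have len: "2 \<le> length xs" using assms(2) distinct_card by fastforce
  have in_X: "xs ! 0 \<in> X" "xs ! 1 \<in> X" "xs ! 0 \<noteq> xs ! 1"
    using len nth_mem[of 0 xs] nth_mem[of 1 xs] nth_eq_iff_index_eq[OF xs(2), of 0 1]
    by (simp_all flip: xs(1) length_greater_0_conv)
  show thesis
  proof (cases "odd (length xs)")
    case True
    define s where "s = cycle_of_list xs"
    have s: "s permutes X" unfolding s_def using cycle_permutes xs(1) by metis
    have next_point: "s (xs ! j) = xs ! Suc j" if "Suc j < length xs" for j
      using cycle_of_list_nth[OF xs(2), of j] that by (simp add: s_def)
    show thesis
    proof (rule that[OF in_X s True])
      show "s ^^ length xs = id" unfolding s_def by (rule cycle_of_list_funpow_length[OF xs(2)])
      show "Sym_from_conjugates X (xs ! 0) (xs ! 1) s"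
      proof (rule Sym_from_conjugatesI)
        fix P :: "('a \<Rightarrow> 'a) set" and p
        assume P: "id \<in> P" "\<And>p q. p \<in> P \<Longrightarrow> q \<in> P \<Longrightarrow> p \<circ> q \<in> P" "transpose (xs ! 0) (xs ! 1) \<in> P"
          "\<And>p. p \<in> P \<Longrightarrow> s \<circ> p \<circ> Hilbert_Choice.inv s \<in> P" and p: "p permutes X"
        have adj: "Suc j < length xs \<Longrightarrow> transpose (xs ! j) (xs ! Suc j) \<in> P" for j
        proof (induction j)
          case (Suc j)
          then show ?case
            using P(4)[of "transpose (xs ! j) (xs ! Suc j)"]
            by (simp add: conj_transpose[OF permutes_bij[OF s]] next_point)
        qed (use P(3) in simp)
        show "p \<in> P"
          using adjacent_transpositions_generate[OF P(1,2) adj xs(2)] p xs(1) by blast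
      qed
    qed
  next
    case False
    obtain a ys where a: "xs = a # ys" using len by (cases xs) auto
    define s where "s = cycle_of_list ys"
    have odd: "odd (length ys)" using False a by simp
    have sY: "s permutes set ys" unfolding s_def by (rule cycle_permutes)
    then have s: "s permutes X" by (rule permutes_subset) (use xs a in auto)
    have fix_a: "s a = a" using permutes_not_in[OF sY] xs a by simp
    have next_point: "s (ys ! j) = ys ! Suc j" if "Suc j < length ys" for j
      using cycle_of_list_nth[of ys j] that xs a by (simp add: s_def)
    have ab: "a \<in> X" "ys ! 0 \<in> X" "a \<noteq> ys ! 0" using in_X a by auto
    show thesis
    proof (rule that[OF ab s odd])
      show "s ^^ length ys = id"
        unfolding s_def using cycle_of_list_funpow_length xs(2) a by auto
      show "Sym_from_conjugates X a (ys ! 0) s"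
      proof (rule Sym_from_conjugatesI)
        fix P :: "('a \<Rightarrow> 'a) set" and p
        assume P: "id \<in> P" "\<And>p q. p \<in> P \<Longrightarrow> q \<in> P \<Longrightarrow> p \<circ> q \<in> P" "transpose a (ys ! 0) \<in> P"
          "\<And>p. p \<in> P \<Longrightarrow> s \<circ> p \<circ> Hilbert_Choice.inv s \<in> P" and p: "p permutes X"
        have star: "j < length ys \<Longrightarrow> transpose a (ys ! j) \<in> P" for j
        proof (induction j)
          case (Suc j)
          then show ?case
            using P(4)[of "transpose a (ys ! j)"]
            by (simp add: conj_transpose[OF permutes_bij[OF s]] next_point fix_a)
        qed (use P(3) in simp)
        show "p \<in> P"
          by (rule star_transpositions_generate[OF assms(1) P(1,2) _ p, of a])
            (use xs a P(1) star in \<open>auto simp: in_set_conv_nth\<close>)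
      qed
    qed
  qed
qed

text \<open>
  Raising the product to the odd power \<open>L\<close> kills \<open>y\<close> and keeps \<open>x\<close>, whose square is trivial.
\<close>

lemma (in group) factors_of_commuting_product:
  assumes H: "subgroup H G" and xy: "x \<in> carrier G" "y \<in> carrier G" "x \<otimes> y = y \<otimes> x"
    and ord: "x \<otimes> x = \<one>" "y [^] L = \<one>" "odd (L::nat)" and prod: "x \<otimes> y \<in> H"
  shows "x \<in> H" "y \<in> H"
proof -
  obtain k where k: "L = Suc (2 * k)" using ord(3) by (elim oddE) simp
  have "x [^] (2::nat) = \<one>" using ord(1) xy(1) by (simp add: numeral_2_eq_2)
  then have "x [^] (2 * k) = \<one>" using xy(1) by (metis nat_pow_pow nat_pow_one)
  then have "(x \<otimes> y) [^] L = x"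
    using pow_mult_distrib[OF xy(3,1,2), of L] ord(2) xy(1) k by simp
  moreover have "(x \<otimes> y) [^] L \<in> H"
    by (induction L) (simp_all add: subgroup.one_closed[OF H] subgroup.m_closed[OF H] prod)
  ultimately show x: "x \<in> H" by simp
  have "y = inv x \<otimes> (x \<otimes> y)" using xy(1,2) by (simp flip: m_assoc)
  then show "y \<in> H"
    using subgroup.m_closed[OF H subgroup.m_inv_closed[OF H x] prod] by simp
qed

section \<open>Subgroups of the generalised wreath product\<close>

locale symmetric_gwr =
  fixes I :: "'i set" and r :: "'i rel" and \<Delta> :: "'i \<Rightarrow> 'a set"
  assumes finite_I: "finite I" and po: "partial_order_on I r"
    and finite_\<Delta>: "\<And>i. i \<in> I \<Longrightarrow> finite (\<Delta> i)" and card_\<Delta>: "\<And>i. i \<in> I \<Longrightarrow> 2 \<le> card (\<Delta> i)"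
begin

abbreviation "GW \<equiv> generalised_wreath_product I r \<Delta> (\<lambda>i. Sym_on (\<Delta> i))"
abbreviation "up \<equiv> above I r"
abbreviation "\<Omega> i \<equiv> PiE (above I r i) \<Delta>"
abbreviation "move f i \<omega> \<equiv> gwr_act I r (above I r i) f \<omega>"

sublocale group GW
  by (rule generalised_wreath_product_group[OF finite_I po Sym_on_permutation_group])

lemmas value_permutes = gwr_value_in(2)[OF finite_I po Sym_on_permutation_group]
lemmas carrier_eqI = gwr_eqI[OF finite_I po Sym_on_permutation_group]
lemmas mult_apply = gwr_mult_apply[OF finite_I po Sym_on_permutation_group]
lemmas one_apply = gwr_one_apply[OF finite_I po Sym_on_permutation_group]
lemmas anc_up = ancestral_above[OF po]
lemmas move_in = gwr_act_in[OF finite_I po Sym_on_permutation_group _ anc_up]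
lemmas inj_on_move = gwr_act_inj[OF finite_I po Sym_on_permutation_group _ anc_up]

lemma finite_\<Omega>: "finite (\<Omega> i)"
  using finite_I finite_\<Delta> by (auto simp: above_def intro!: finite_PiE)

lemma ancestral_subset: "ancestral I r J \<Longrightarrow> J \<subseteq> I" and ancestral_up: "ancestral I r J \<Longrightarrow> j \<in> J \<Longrightarrow> up j \<subseteq> J"
  by (auto simp: ancestral_def)

lemma not_in_up: "i \<notin> up i"
  by (simp add: above_def)

lemma move_cong:
  assumes "\<And>j \<nu>. j \<in> up i \<Longrightarrow> \<nu> \<in> \<Omega> j \<Longrightarrow> f j \<nu> = h j \<nu>" "\<omega> \<in> \<Omega> i"
  shows "move f i \<omega> = move h i \<omega>"
  unfolding gwr_act_def
  using assms restrict_PiE_above[OF finite_I po Sym_on_permutation_group anc_up assms(2)]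
  by (intro restrict_ext) auto

lemma move_id:
  assumes "\<And>j \<nu>. j \<in> up i \<Longrightarrow> \<nu> \<in> \<Omega> j \<Longrightarrow> f j \<nu> = id" "\<omega> \<in> \<Omega> i"
  shows "move f i \<omega> = \<omega>"
proof -
  have "move f i \<omega> = restrict \<omega> (up i)"
    unfolding gwr_act_def
    using assms restrict_PiE_above[OF finite_I po Sym_on_permutation_group anc_up assms(2)]
    by (intro restrict_ext) auto
  then show ?thesis using assms(2) by (metis PiE_restrict)
qed

definition tabulate :: "('i \<Rightarrow> ('i \<Rightarrow> 'a) \<Rightarrow> 'a \<Rightarrow> 'a) \<Rightarrow> 'i \<Rightarrow> ('i \<Rightarrow> 'a) \<Rightarrow> 'a \<Rightarrow> 'a" where
  "tabulate F = (\<lambda>i\<in>I. \<lambda>\<omega>\<in>\<Omega> i. F i \<omega>)"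

lemma tabulate_apply [simp]: "i \<in> I \<Longrightarrow> \<omega> \<in> \<Omega> i \<Longrightarrow> tabulate F i \<omega> = F i \<omega>"
  by (simp add: tabulate_def)

lemma tabulate_in: "(\<And>i \<omega>. i \<in> I \<Longrightarrow> \<omega> \<in> \<Omega> i \<Longrightarrow> F i \<omega> permutes \<Delta> i) \<Longrightarrow> tabulate F \<in> carrier GW"
  by (auto simp: tabulate_def generalised_wreath_product_def gwr_component_def Sym_on_def)

text \<open>
  The elements supported on \<open>J\<close>. For ancestral \<open>J\<close> this is a copy of the generalised wreath
  product over \<open>J\<close>, so that the induction over \<open>J\<close> can take place inside the one group \<open>GW\<close>.
\<close>

definition U :: "'i set \<Rightarrow> ('i \<Rightarrow> ('i \<Rightarrow> 'a) \<Rightarrow> 'a \<Rightarrow> 'a) set" where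
  "U J = {f \<in> carrier GW. \<forall>j\<in>I - J. \<forall>\<nu>\<in>\<Omega> j. f j \<nu> = id}"

lemma U_carrier: "f \<in> U J \<Longrightarrow> f \<in> carrier GW" and U_id: "f \<in> U J \<Longrightarrow> j \<in> I \<Longrightarrow> j \<notin> J \<Longrightarrow> \<nu> \<in> \<Omega> j \<Longrightarrow> f j \<nu> = id"
  by (auto simp: U_def)

lemma U_I: "U I = carrier GW"
  by (auto simp: U_def)

lemma U_mono: "J \<subseteq> K \<Longrightarrow> U J \<subseteq> U K"
  by (auto simp: U_def)

lemma tabulate_in_U:
  assumes "\<And>i \<omega>. i \<in> I \<Longrightarrow> \<omega> \<in> \<Omega> i \<Longrightarrow> F i \<omega> permutes \<Delta> i"
    and "\<And>i \<omega>. i \<in> I \<Longrightarrow> i \<notin> J \<Longrightarrow> \<omega> \<in> \<Omega> i \<Longrightarrow> F i \<omega> = id"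
  shows "tabulate F \<in> U J"
  using assms by (auto simp: U_def tabulate_in)

definition proj :: "'i set \<Rightarrow> ('i \<Rightarrow> ('i \<Rightarrow> 'a) \<Rightarrow> 'a \<Rightarrow> 'a) \<Rightarrow> 'i \<Rightarrow> ('i \<Rightarrow> 'a) \<Rightarrow> 'a \<Rightarrow> 'a" where
  "proj J f = tabulate (\<lambda>j \<nu>. if j \<in> J then f j \<nu> else id)"

lemma proj_in_U: "f \<in> carrier GW \<Longrightarrow> proj J f \<in> U J"
  unfolding proj_def by (rule tabulate_in_U) (auto simp: value_permutes permutes_id)

lemma proj_U: "f \<in> U J \<Longrightarrow> proj J f = f"
  by (rule carrier_eqI[OF U_carrier[OF proj_in_U] U_carrier])
    (auto simp: U_carrier U_id proj_def)

lemma move_proj: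
  assumes "up i \<subseteq> J" "\<omega> \<in> \<Omega> i"
  shows "move (proj J f) i \<omega> = move f i \<omega>"
  using assms by (intro move_cong) (auto simp: proj_def above_def)

lemma proj_hom:
  assumes "ancestral I r J"
  shows "group_hom GW GW (proj J)"
proof -
  have "proj J (f \<otimes>\<^bsub>GW\<^esub> h) = proj J f \<otimes>\<^bsub>GW\<^esub> proj J h"
    if f: "f \<in> carrier GW" and h: "h \<in> carrier GW" for f h
  proof (rule carrier_eqI)
    show "proj J (f \<otimes>\<^bsub>GW\<^esub> h) \<in> carrier GW" "proj J f \<otimes>\<^bsub>GW\<^esub> proj J h \<in> carrier GW"
      using f h proj_in_U U_carrier by blast+
    fix i \<omega> assume i: "i \<in> I" and \<omega>: "\<omega> \<in> \<Omega> i"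
    have m: "move (proj J f) i \<omega> \<in> \<Omega> i"
      using f \<omega> by (intro move_in U_carrier[OF proj_in_U])
    show "proj J (f \<otimes>\<^bsub>GW\<^esub> h) i \<omega> = (proj J f \<otimes>\<^bsub>GW\<^esub> proj J h) i \<omega>"
      using i \<omega> m move_proj[OF ancestral_up[OF assms] \<omega>, of f]
      by (auto simp: mult_apply proj_def[of J h] proj_def[of J "f \<otimes>\<^bsub>GW\<^esub> h"])
        (auto simp: proj_def)
  qed
  moreover have "proj J f \<in> carrier GW" if "f \<in> carrier GW" for f
    using that proj_in_U U_carrier by blast
  ultimately show ?thesis
    by (intro group_hom.intro group_hom_axioms.intro is_group homI) auto
qed

lemma U_subgroup: "ancestral I r J \<Longrightarrow> subgroup (U J) GW"
proof -
  assume J: "ancestral I r J"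
  have "U J = proj J ` carrier GW"
  proof
    show "U J \<subseteq> proj J ` carrier GW"
      using proj_U U_carrier by (metis image_eqI subsetI)
  qed (use proj_in_U in blast)
  then show ?thesis
    using group_hom.img_is_subgroup[OF proj_hom[OF J]] by simp
qed

definition single :: "'i \<Rightarrow> ('i \<Rightarrow> 'a) \<Rightarrow> ('a \<Rightarrow> 'a) \<Rightarrow> 'i \<Rightarrow> ('i \<Rightarrow> 'a) \<Rightarrow> 'a \<Rightarrow> 'a" where
  "single i \<omega> p = tabulate (\<lambda>j \<nu>. if j = i \<and> \<nu> = \<omega> then p else id)"

lemma single_apply:
  "j \<in> I \<Longrightarrow> \<nu> \<in> \<Omega> j \<Longrightarrow> single i \<omega> p j \<nu> = (if j = i \<and> \<nu> = \<omega> then p else id)"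
  by (simp add: single_def)

lemma single_in_U: "p permutes \<Delta> i \<Longrightarrow> i \<in> J \<Longrightarrow> single i \<omega> p \<in> U J"
  unfolding single_def by (rule tabulate_in_U) (auto simp: permutes_id)

lemma single_in: "p permutes \<Delta> i \<Longrightarrow> single i \<omega> p \<in> carrier GW"
  using single_in_U U_carrier by blast

lemma move_single:
  assumes "i \<notin> up j" "\<nu> \<in> \<Omega> j"
  shows "move (single i \<omega> p) j \<nu> = \<nu>"
  using assms by (intro move_id) (auto simp: single_apply above_def)

lemma single_mult:
  assumes "p permutes \<Delta> i" "q permutes \<Delta> i"
  shows "single i \<omega> p \<otimes>\<^bsub>GW\<^esub> single i \<omega> q = single i \<omega> (q \<circ> p)"
proof (rule carrier_eqI)
  show "single i \<omega> p \<otimes>\<^bsub>GW\<^esub> single i \<omega> q \<in> carrier GW" "single i \<omega> (q \<circ> p) \<in> carrier GW"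
    using assms by (auto intro!: single_in permutes_compose)
  fix j \<nu> assume j: "j \<in> I" and \<nu>: "\<nu> \<in> \<Omega> j"
  have "move (single i \<omega> p) j \<nu> \<in> \<Omega> j" using single_in[OF assms(1)] \<nu> by (rule move_in)
  then show "(single i \<omega> p \<otimes>\<^bsub>GW\<^esub> single i \<omega> q) j \<nu> = single i \<omega> (q \<circ> p) j \<nu>"
    using j \<nu> by (cases "j = i") (simp_all add: mult_apply single_apply move_single[OF not_in_up])
qed

lemma single_id: "single i \<omega> id = \<one>\<^bsub>GW\<^esub>"
  by (rule carrier_eqI) (auto simp: single_apply one_apply intro!: single_in permutes_id)

lemma single_pow:
  assumes "p permutes \<Delta> i"
  shows "single i \<omega> p [^]\<^bsub>GW\<^esub> n = single i \<omega> (p ^^ n)"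
  using assms by (induction n) (simp_all add: single_id[unfolded id_def] id_def single_mult permutes_funpow)

lemma single_comp_closed:
  assumes H: "subgroup H GW" and "single i \<omega> p \<in> H" "single i \<omega> q \<in> H"
    and "p permutes \<Delta> i" "q permutes \<Delta> i"
  shows "single i \<omega> (p \<circ> q) \<in> H"
  using subgroup.m_closed[OF H assms(3,2)] assms(4,5) by (simp add: single_mult)

text \<open>
  Conjugation by \<open>f\<close> moves the point along the action and conjugates the value. It matters that no
  index of \<open>insert i J\<close> lies below \<open>i\<close>: a component of \<open>f\<close> below \<open>i\<close> would see the change at \<open>i\<close>, and
  the conjugate would no longer be concentrated at \<open>i\<close>.
\<close>

lemma single_conj:
  assumes J: "ancestral I r J" "ancestral I r (insert i J)" "i \<notin> J"
    and f: "f \<in> U (insert i J)" and \<omega>: "\<omega> \<in> \<Omega> i" and p: "p permutes \<Delta> i"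
  shows "single i \<omega> p \<otimes>\<^bsub>GW\<^esub> f
    = f \<otimes>\<^bsub>GW\<^esub> single i (move f i \<omega>) (f i \<omega> \<circ> p \<circ> Hilbert_Choice.inv (f i \<omega>))"
    (is "_ = _ \<otimes>\<^bsub>GW\<^esub> single i _ ?q")
proof (rule carrier_eqI)
  have i: "i \<in> I" using J(2) ancestral_subset by blast
  have fi: "f i \<omega> permutes \<Delta> i" using f U_carrier i \<omega> value_permutes by blast
  have q: "?q permutes \<Delta> i" using fi p by (intro permutes_compose permutes_inv)
  note fW = U_carrier[OF f]
  show "single i \<omega> p \<otimes>\<^bsub>GW\<^esub> f \<in> carrier GW" "f \<otimes>\<^bsub>GW\<^esub> single i (move f i \<omega>) ?q \<in> carrier GW"
    using single_in[OF p] single_in[OF q] fW by auto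
  fix j \<nu> assume j: "j \<in> I" and \<nu>: "\<nu> \<in> \<Omega> j"
  have m1: "move (single i \<omega> p) j \<nu> \<in> \<Omega> j" and m2: "move f j \<nu> \<in> \<Omega> j"
    using single_in[OF p] fW \<nu> by (auto intro!: move_in)
  show "(single i \<omega> p \<otimes>\<^bsub>GW\<^esub> f) j \<nu> = (f \<otimes>\<^bsub>GW\<^esub> single i (move f i \<omega>) ?q) j \<nu>"
  proof (cases "j = i")
    case True
    have "move f i \<nu> = move f i \<omega> \<longleftrightarrow> \<nu> = \<omega>"
      using inj_on_move[OF fW] \<nu> \<omega> True by (auto dest: inj_onD)
    moreover have "?q \<circ> f i \<omega> = f i \<omega> \<circ> p"
      using permutes_inv_o(2)[OF fi] by (simp add: comp_assoc)
    ultimately show ?thesis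
      using j \<nu> m2 True by (simp add: mult_apply single_apply move_single[OF not_in_up])
  next
    case False
    have "f j (move (single i \<omega> p) j \<nu>) = f j \<nu>"
    proof (cases "j \<in> J")
      case True
      then have "i \<notin> up j" using ancestral_up[OF J(1)] J(3) by blast
      then show ?thesis using \<nu> by (simp add: move_single)
    next
      case jJ: False
      then show ?thesis using U_id[OF f j] False m1 \<nu> by simp
    qed
    then show ?thesis using j \<nu> m2 False by (simp add: mult_apply single_apply)
  qed
qed

lemma single_conj_closed:
  assumes J: "ancestral I r J" "ancestral I r (insert i J)" "i \<notin> J"
    and H: "subgroup H GW" and f: "f \<in> H" "f \<in> U (insert i J)" and \<omega>: "\<omega> \<in> \<Omega> i" and p: "p permutes \<Delta> i"
    and s: "single i \<omega> p \<in> H"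
  shows "single i (move f i \<omega>) (f i \<omega> \<circ> p \<circ> Hilbert_Choice.inv (f i \<omega>)) \<in> H" (is "?s \<in> H")
proof -
  have i: "i \<in> I" using J(2) ancestral_subset by blast
  have fi: "f i \<omega> permutes \<Delta> i" using f(2) U_carrier i \<omega> value_permutes by blast
  have "?s \<in> carrier GW" using fi p by (intro single_in permutes_compose permutes_inv)
  then have "?s = inv\<^bsub>GW\<^esub> f \<otimes>\<^bsub>GW\<^esub> (single i \<omega> p \<otimes>\<^bsub>GW\<^esub> f)"
    using U_carrier[OF f(2)] single_conj[OF J f(2) \<omega> p] by (simp flip: m_assoc)
  then show ?thesis
    using f(1) s subgroup.m_closed[OF H] subgroup.m_inv_closed[OF H] by simp
qed

section \<open>Adding one index costs one generator\<close>

text \<open>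
  Since \<open>U J\<close> acts transitively on \<open>\<Omega> i\<close> and \<open>H\<close> covers it, conjugation carries the symmetric group at
  \<open>\<omega>\<close> to every other point. Hence \<open>H\<close> contains the layer \<open>U {i}\<close>, the kernel of the projection to \<open>U J\<close>.
\<close>

lemma layer_from_point:
  assumes J: "ancestral I r J" "ancestral I r (insert i J)" "i \<notin> J"
    and H: "subgroup H GW" "H \<subseteq> U (insert i J)" and cover: "U J \<subseteq> proj J ` H"
    and \<omega>: "\<omega> \<in> \<Omega> i" and point: "\<And>p. p permutes \<Delta> i \<Longrightarrow> single i \<omega> p \<in> H"
  shows "U (insert i J) \<subseteq> H"
proof
  have i: "i \<in> I" using J(2) ancestral_subset by blast
  have upJ: "up i \<subseteq> J" using ancestral_up[OF J(2), of i] not_in_up by blast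
  have single_H: "single i \<nu> p \<in> H" if \<nu>: "\<nu> \<in> \<Omega> i" and p: "p permutes \<Delta> i" for \<nu> p
  proof -
    \<comment> \<open>independent transpositions in the coordinates above \<open>i\<close> take \<open>\<omega>\<close> to \<open>\<nu>\<close>\<close>
    define f where "f = tabulate (\<lambda>j _. if j \<in> up i then transpose (\<omega> j) (\<nu> j) else id)"
    have f: "f \<in> U J"
      unfolding f_def
    proof (rule tabulate_in_U)
      fix j :: 'i and \<eta> :: "'i \<Rightarrow> 'a"
      show "(if j \<in> up i then transpose (\<omega> j) (\<nu> j) else id) permutes \<Delta> j"
        using PiE_mem[OF \<omega>, of j] PiE_mem[OF \<nu>, of j] by (auto intro: permutes_swap_id permutes_id)
    qed (use upJ in auto)
    obtain h where h: "h \<in> H" "proj J h = f" using cover f by blast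
    have hU: "h \<in> U (insert i J)" using h(1) H(2) by blast
    have "move h i \<omega> = move f i \<omega>" using move_proj[OF upJ \<omega>, of h] h(2) by simp
    also have "\<dots> = \<nu>"
    proof
      fix j
      show "move f i \<omega> j = \<nu> j"
      proof (cases "j \<in> up i")
        case True
        then have "j \<in> I" by (simp add: above_def)
        then show ?thesis
          using True restrict_PiE_above[OF finite_I po Sym_on_permutation_group anc_up \<omega> True]
          by (simp add: gwr_act_def f_def)
      next
        case False
        then show ?thesis using PiE_arb[OF \<nu>] by (simp add: gwr_act_def)
      qed
    qed
    finally have mv: "move h i \<omega> = \<nu>" .
    have hi: "h i \<omega> permutes \<Delta> i" using hU U_carrier i \<omega> value_permutes by blast
    define q where "q = Hilbert_Choice.inv (h i \<omega>) \<circ> p \<circ> h i \<omega>"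
    have q: "q permutes \<Delta> i" unfolding q_def using hi p by (intro permutes_compose permutes_inv)
    have "h i \<omega> \<circ> q \<circ> Hilbert_Choice.inv (h i \<omega>) = p"
      unfolding q_def using permutes_inverses[OF hi] by (simp add: fun_eq_iff)
    then show ?thesis
      using single_conj_closed[OF J H(1) h(1) hU \<omega> q point[OF q]] mv by simp
  qed
  have layer_H: "tabulate (\<lambda>j \<nu>. if j = i \<and> \<nu> \<in> T then g \<nu> else id) \<in> H"
    if "T \<subseteq> \<Omega> i" and g: "\<And>\<nu>. \<nu> \<in> \<Omega> i \<Longrightarrow> g \<nu> permutes \<Delta> i" for T g
    using finite_subset[OF that(1) finite_\<Omega>] that(1)
  proof (induction T rule: finite_induct)
    case empty
    have "tabulate (\<lambda>j \<nu>. if j = i \<and> \<nu> \<in> {} then g \<nu> else id) = \<one>\<^bsub>GW\<^esub>"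
      by (rule carrier_eqI[OF tabulate_in one_closed]) (simp_all only: tabulate_apply one_apply empty_iff
          simp_thms if_False permutes_id)
    then show ?case using subgroup.one_closed[OF H(1)] by (simp only:)
  next
    case (insert \<nu> T)
    define e where "e T = tabulate (\<lambda>j \<nu>. if j = i \<and> \<nu> \<in> T then g \<nu> else id)" for T
    have e_in: "e T \<in> carrier GW" for T
      unfolding e_def using g by (intro tabulate_in) (auto intro: permutes_id)
    have s_in: "single i \<nu> (g \<nu>) \<in> carrier GW" using insert.prems g by (intro single_in) auto
    have "e (insert \<nu> T) = e T \<otimes>\<^bsub>GW\<^esub> single i \<nu> (g \<nu>)"
    proof (rule carrier_eqI[OF e_in m_closed[OF e_in s_in]])
      fix j \<eta> assume j: "j \<in> I" and \<eta>: "\<eta> \<in> \<Omega> j"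
      have "move (e T) j \<eta> \<in> \<Omega> j" using e_in \<eta> by (rule move_in)
      moreover have "move (e T) i \<eta> = \<eta>" if "\<eta> \<in> \<Omega> i"
        by (rule move_id[OF _ that]) (auto simp: e_def above_def id_def)
      moreover have "e T' j \<eta> = (if j = i \<and> \<eta> \<in> T' then g \<eta> else id)" for T'
        using j \<eta> by (simp add: e_def)
      ultimately show "e (insert \<nu> T) j \<eta> = (e T \<otimes>\<^bsub>GW\<^esub> single i \<nu> (g \<nu>)) j \<eta>"
        using j \<eta> insert.hyps(2) by (cases "j = i") (auto simp: mult_apply single_apply)
    qed
    moreover have "e T \<in> H" using insert.IH insert.prems unfolding e_def by blast
    moreover have "single i \<nu> (g \<nu>) \<in> H" using insert.prems g by (intro single_H) auto
    ultimately have "e (insert \<nu> T) \<in> H" by (simp add: subgroup.m_closed[OF H(1)])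
    then show ?case unfolding e_def .
  qed
  fix f assume f: "f \<in> U (insert i J)"
  interpret \<pi>: group_hom GW GW "proj J" by (rule proj_hom[OF J(1)])
  obtain h where h: "h \<in> H" "proj J h = proj J f"
    using cover proj_in_U[OF U_carrier[OF f]] by (metis imageE subsetD)
  have hU: "h \<in> U (insert i J)" using h(1) H(2) by blast
  note fW = U_carrier[OF f] and hW = U_carrier[OF hU]
  define k where "k = inv\<^bsub>GW\<^esub> h \<otimes>\<^bsub>GW\<^esub> f"
  have kU: "k \<in> U (insert i J)"
    unfolding k_def using U_subgroup[OF J(2)] f hU by (simp add: subgroup.m_closed subgroup.m_inv_closed)
  note kW = U_carrier[OF kU]
  have "proj J k = \<one>\<^bsub>GW\<^esub>"
    using hW fW h(2) unfolding k_def by (simp add: \<pi>.hom_inv)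
  then have k_id: "k j \<nu> = id" if "j \<in> I" "\<nu> \<in> \<Omega> j" "j \<in> J" for j \<nu>
    using that tabulate_apply[OF that(1,2), of "\<lambda>j \<nu>. if j \<in> J then k j \<nu> else id"]
    by (simp add: proj_def one_apply)
  have kp: "k i \<nu> permutes \<Delta> i" if "\<nu> \<in> \<Omega> i" for \<nu> using value_permutes[OF kW i that] .
  have "k = tabulate (\<lambda>j \<nu>. if j = i \<and> \<nu> \<in> \<Omega> i then k i \<nu> else id)"
  proof (rule carrier_eqI[OF kW tabulate_in])
    show "(if j = i \<and> \<nu> \<in> \<Omega> i then k i \<nu> else id) permutes \<Delta> j" for j \<nu>
      using kp by (auto intro: permutes_id)
    show "k j \<nu> = tabulate (\<lambda>j \<nu>. if j = i \<and> \<nu> \<in> \<Omega> i then k i \<nu> else id) j \<nu>"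
      if "j \<in> I" "\<nu> \<in> \<Omega> j" for j \<nu>
      using that k_id[OF that] U_id[OF kU that(1) _ that(2)] by auto
  qed
  from this[symmetric] have "k \<in> H" using layer_H[OF order_refl, of "k i"] kp by simp
  moreover have "f = h \<otimes>\<^bsub>GW\<^esub> k" unfolding k_def using fW hW by (simp flip: m_assoc)
  ultimately show "f \<in> H" using h(1) subgroup.m_closed[OF H(1)] by simp
qed

text \<open>
  The generating set is nonempty because \<open>generated_insert\<close> modifies one of its elements.
\<close>

definition generated_by_at_most :: "nat \<Rightarrow> 'i set \<Rightarrow> bool" where
  "generated_by_at_most k J \<longleftrightarrow>
    (\<exists>S\<subseteq>U J. finite S \<and> S \<noteq> {} \<and> card S \<le> k \<and> U J \<subseteq> generate GW S)"

lemma point_permutations: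
  assumes H: "subgroup H GW" and i: "i \<in> I" and \<omega>: "\<omega> \<in> \<Omega> i" and ab: "a \<in> \<Delta> i" "b \<in> \<Delta> i"
    and gen: "Sym_from_conjugates (\<Delta> i) a b s"
    and s: "s permutes \<Delta> i"
    and t: "single i \<omega> (transpose a b) \<in> H"
    and conj: "\<And>p. p permutes \<Delta> i \<Longrightarrow> single i \<omega> p \<in> H
      \<Longrightarrow> single i \<omega> (s \<circ> p \<circ> Hilbert_Choice.inv s) \<in> H"
    and p: "p permutes \<Delta> i"
  shows "single i \<omega> p \<in> H"
proof -
  have "p \<in> {p. p permutes \<Delta> i \<and> single i \<omega> p \<in> H}"
  proof (rule Sym_from_conjugatesD[OF gen _ _ _ _ p])
    show "id \<in> {p. p permutes \<Delta> i \<and> single i \<omega> p \<in> H}"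
      using subgroup.one_closed[OF H] by (simp add: single_id permutes_id)
    show "transpose a b \<in> {p. p permutes \<Delta> i \<and> single i \<omega> p \<in> H}"
      using t ab by (simp add: permutes_swap_id)
  qed (use s conj single_comp_closed[OF H] in \<open>auto intro: permutes_compose permutes_inv\<close>)
  then show ?thesis by simp
qed

text \<open>
  Both \<open>s\<close> and the transposition sit at the same point \<open>\<omega>\<close>. Conjugation by \<open>y = x s\<close> moves a point of
  \<open>\<Omega> i\<close> as \<open>x\<close> does and leaves the value alone, except when the point arrives at \<open>\<omega>\<close>, where the value is
  conjugated by \<open>s\<close>. As the points lie on finite cycles, every value at \<open>\<omega>\<close> eventually returns there,
  conjugated by \<open>s\<close> exactly once.
\<close>

lemma generated_insert:
  assumes J: "ancestral I r J" "ancestral I r (insert i J)" "i \<notin> J" and gen: "generated_by_at_most k J"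
  shows "generated_by_at_most (Suc k) (insert i J)"
proof -
  have i: "i \<in> I" using J(2) ancestral_subset by blast
  have upJ: "up i \<subseteq> J" using ancestral_up[OF J(2), of i] not_in_up by blast
  obtain S where S: "S \<subseteq> U J" "finite S" "S \<noteq> {}" "card S \<le> k" "U J \<subseteq> generate GW S"
    using gen unfolding generated_by_at_most_def by blast
  obtain x where x: "x \<in> S" using S(3) by blast
  obtain a b s L where ab: "a \<in> \<Delta> i" "b \<in> \<Delta> i" and s: "s permutes \<Delta> i"
    and sgen: "Sym_from_conjugates (\<Delta> i) a b s"
    by (rule odd_order_and_transposition_generate[OF finite_\<Delta>[OF i] card_\<Delta>[OF i]]) blast
  have "\<forall>j\<in>I. \<Delta> j \<noteq> {}" using card_\<Delta> by fastforce
  then have "\<Omega> i \<noteq> {}" by (auto simp: PiE_eq_empty_iff above_def)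
  then obtain \<omega> where \<omega>: "\<omega> \<in> \<Omega> i" by blast
  let ?t = "single i \<omega> (transpose a b)"
  define y where "y = x \<otimes>\<^bsub>GW\<^esub> single i \<omega> s"
  define S' where "S' = insert ?t (insert y (S - {x}))"
  define H where "H = generate GW S'"
  have JU: "U J \<subseteq> U (insert i J)" by (intro U_mono) blast
  note sub = U_subgroup[OF J(2)]
  have xU: "x \<in> U J" using x S(1) by blast
  have yU: "y \<in> U (insert i J)"
    unfolding y_def using xU JU single_in_U[OF s] by (auto intro!: subgroup.m_closed[OF sub])
  have tr: "transpose a b permutes \<Delta> i" using ab by (simp add: permutes_swap_id)
  have S'U: "S' \<subseteq> U (insert i J)"
    unfolding S'_def using yU S(1) JU single_in_U[OF tr] by auto
  have S'W: "S' \<subseteq> carrier GW" using S'U U_carrier by blast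
  have H: "subgroup H GW" unfolding H_def by (rule generate_is_subgroup[OF S'W])
  have HU: "H \<subseteq> U (insert i J)" unfolding H_def by (rule generate_subgroup_incl[OF S'U sub])
  have "card S = Suc (card (S - {x}))" using x S(2) by (rule card.remove[rotated])
  then have "card S' \<le> Suc (card S)" unfolding S'_def using S(2) by (simp add: card_insert_if)
  then have card: "card S' \<le> Suc k" using S(4) by simp
  have yH: "y \<in> H" and tH: "?t \<in> H" unfolding H_def S'_def by (auto intro: generate.incl)
  have fin: "finite S'" unfolding S'_def using S(2) by simp
  interpret \<pi>: group_hom GW GW "proj J" by (rule proj_hom[OF J(1)])
  have "proj J (single i \<omega> s) = \<one>\<^bsub>GW\<^esub>"
  proof (rule carrier_eqI[OF U_carrier[OF proj_in_U[OF single_in[OF s]]] one_closed])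
    fix j \<nu> assume "j \<in> I" "\<nu> \<in> \<Omega> j"
    then show "proj J (single i \<omega> s) j \<nu> = \<one>\<^bsub>GW\<^esub> j \<nu>"
      using J(3) by (cases "j \<in> J") (auto simp: proj_def single_apply one_apply)
  qed
  then have py: "proj J y = x"
    unfolding y_def using U_carrier[OF xU] single_in[OF s] proj_U[OF xU] by simp
  have "S \<subseteq> proj J ` S'"
  proof
    fix z assume z: "z \<in> S"
    show "z \<in> proj J ` S'"
    proof (cases "z = x")
      case True
      then show ?thesis using py by (intro image_eqI[of _ _ y]) (simp_all add: S'_def)
    next
      case False
      then show ?thesis
        using z S(1) proj_U[of z J] by (intro image_eqI[of _ _ z]) (auto simp: S'_def)
    qed
  qed
  from mono_generate[OF this] have cover: "U J \<subseteq> proj J ` H"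
    using S(5) unfolding H_def \<pi>.generate_img[OF S'W] by (rule order_trans[rotated])
  have y_val: "y i \<nu> = (if move x i \<nu> = \<omega> then s else id)" if "\<nu> \<in> \<Omega> i" for \<nu>
    using that i U_id[OF xU i J(3) that] move_in[OF U_carrier[OF xU] that]
    unfolding y_def by (simp add: mult_apply single_apply)
  have y_move: "move y i \<nu> = move x i \<nu>" if "\<nu> \<in> \<Omega> i" for \<nu>
    using move_proj[OF upJ that, of y] py by simp
  have conj_y: "single i (move x i \<nu>) (y i \<nu> \<circ> p \<circ> Hilbert_Choice.inv (y i \<nu>)) \<in> H"
    if "\<nu> \<in> \<Omega> i" "p permutes \<Delta> i" "single i \<nu> p \<in> H" for \<nu> p
    using single_conj_closed[OF J H yH yU that] y_move[OF that(1)] by simp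
  \<comment> \<open>If no point of \<open>Q\<close> were sent to \<open>\<omega>\<close>, then \<open>x\<close> would map the finite set \<open>Q\<close> injectively into
    \<open>Q - {\<omega>}\<close>; this takes the place of counting the length of the cycle through \<open>\<omega>\<close>.\<close>
  define Q where "Q = {\<nu> \<in> \<Omega> i. \<forall>p. p permutes \<Delta> i \<longrightarrow> single i \<omega> p \<in> H \<longrightarrow> single i \<nu> p \<in> H}"
  have "\<exists>\<nu>\<in>Q. move x i \<nu> = \<omega>"
  proof (rule ccontr)
    assume no: "\<not> (\<exists>\<nu>\<in>Q. move x i \<nu> = \<omega>)"
    have "move x i ` Q \<subseteq> Q"
    proof
      fix \<eta> assume "\<eta> \<in> move x i ` Q"
      then obtain \<nu> where \<nu>: "\<nu> \<in> Q" "\<eta> = move x i \<nu>" by blast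
      then have "y i \<nu> = id" using no y_val by (auto simp: Q_def)
      then show "\<eta> \<in> Q"
        using \<nu> conj_y[of \<nu>] move_in[OF U_carrier[OF xU]] by (auto simp: Q_def)
    qed
    moreover have "finite Q" using finite_\<Omega> by (simp add: Q_def)
    moreover have "inj_on (move x i) Q"
      using inj_on_move[OF U_carrier[OF xU]] by (rule inj_on_subset) (auto simp: Q_def)
    ultimately have "move x i ` Q = Q" by (intro endo_inj_surj)
    moreover have "\<omega> \<in> Q" using \<omega> by (simp add: Q_def)
    ultimately show False using no by (metis imageE)
  qed
  then obtain \<nu> where \<nu>: "\<nu> \<in> Q" "move x i \<nu> = \<omega>" by blast
  have conj: "single i \<omega> (s \<circ> p \<circ> Hilbert_Choice.inv s) \<in> H"
    if "p permutes \<Delta> i" "single i \<omega> p \<in> H" for p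
    using conj_y[of \<nu> p] \<nu> that y_val[of \<nu>] by (simp add: Q_def)
  have "U (insert i J) \<subseteq> H"
    by (rule layer_from_point[OF J H HU cover \<omega>])
      (rule point_permutations[OF H i \<omega> ab sgen s tH conj])
  then show ?thesis
    unfolding generated_by_at_most_def H_def using S'U fin card
    by (intro exI[of _ S']) (simp add: S'_def)
qed

section \<open>Two indices\<close>

lemma single_inv:
  assumes "p permutes \<Delta> i"
  shows "inv\<^bsub>GW\<^esub> (single i \<omega> p) = single i \<omega> (Hilbert_Choice.inv p)"
  using assms
  by (intro inv_equality) (simp_all add: single_mult permutes_inv single_in permutes_inv_o single_id)

lemma point_generated:
  assumes H: "subgroup H GW" and i: "i \<in> I" and \<omega>: "\<omega> \<in> \<Omega> i" and ab: "a \<in> \<Delta> i" "b \<in> \<Delta> i"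
    and gen: "Sym_from_conjugates (\<Delta> i) a b s"
    and s: "s permutes \<Delta> i" "single i \<omega> s \<in> H"
    and t: "single i \<omega> (transpose a b) \<in> H"
    and p: "p permutes \<Delta> i"
  shows "single i \<omega> p \<in> H"
proof (rule point_permutations[OF H i \<omega> ab gen s(1) t _ p])
  fix p assume p: "p permutes \<Delta> i" "single i \<omega> p \<in> H"
  have "single i \<omega> (Hilbert_Choice.inv s) \<in> H"
    using subgroup.m_inv_closed[OF H s(2)] single_inv[OF s(1)] by simp
  then show "single i \<omega> (s \<circ> p \<circ> Hilbert_Choice.inv s) \<in> H"
    using p s by (intro single_comp_closed[OF H]) (auto intro: permutes_compose permutes_inv)
qed

text \<open>
  Since nothing lies above \<open>b\<close>, the set \<open>\<Omega> b\<close> has one point \<open>u\<close>, and \<open>top = single b u\<close> identifies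
  the symmetric group on \<open>\<Delta> b\<close> with \<open>U {b}\<close>. If \<open>a\<close> is incomparable to \<open>b\<close>, each generator
  pairs a transposition at one index with an odd-order element at the other. In a chain, \<open>\<Omega> a\<close> is
  a copy of \<open>\<Delta> b\<close>; for three or more points \<open>x0, x1, x2, ...\<close> of \<open>\<Delta> b\<close>, the generators are
  \<open>top (x0 x1)\<close> times an odd-order element at the point \<open>x2\<close>, and \<open>top\<close> of the cycle through all
  points times a transposition at the point \<open>x0\<close>.
\<close>

lemma generated_pair:
  assumes J: "ancestral I r {b}" "ancestral I r (insert a {b})" "a \<noteq> b"
  shows "generated_by_at_most 2 {a, b}"
proof -
  define u :: "'i \<Rightarrow> 'a" where "u = (\<lambda>_. undefined)"
  define top where "top q = single b u q" for q
  have I: "a \<in> I" "b \<in> I" using J(2) ancestral_subset by blast+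
  have upb: "up b = {}" using ancestral_up[OF J(1), of b] not_in_up[of b] by blast
  have upa: "up a \<subseteq> {b}" using ancestral_up[OF J(2), of a] not_in_up[of a] by blast
  have \<Omega>b: "\<Omega> b = {u}" by (simp add: upb u_def)
  have anb: "a \<notin> {b}" using J(3) by simp
  have ub: "u \<in> \<Omega> b" using \<Omega>b by simp
  note sub = U_subgroup[OF J(2)]
  have top_U: "top q \<in> U {b}" "top q \<in> U (insert a {b})" "top q \<in> carrier GW" if "q permutes \<Delta> b" for q
    unfolding top_def using that by (simp_all add: single_in_U single_in)
  have top_mult: "top p \<otimes>\<^bsub>GW\<^esub> top q = top (q \<circ> p)" if "p permutes \<Delta> b" "q permutes \<Delta> b" for p q
    unfolding top_def using that by (rule single_mult)
  have sU: "single a \<omega> p \<in> U (insert a {b})" "single a \<omega> p \<in> carrier GW" if "p permutes \<Delta> a" for \<omega> p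
    using that by (simp_all add: single_in_U single_in)
  have U_top: "f = top (f b u)" if f: "f \<in> U {b}" for f
  proof (rule carrier_eqI[OF U_carrier[OF f]])
    have "f b u permutes \<Delta> b" using value_permutes[OF U_carrier[OF f] I(2)] \<Omega>b by simp
    then show "top (f b u) \<in> carrier GW" by (rule top_U)
    show "f j \<nu> = top (f b u) j \<nu>" if "j \<in> I" "\<nu> \<in> \<Omega> j" for j \<nu>
      using that U_id[OF f that(1) _ that(2)] \<Omega>b by (cases "j = b") (auto simp: top_def single_apply)
  qed
  have top_a: "top q a \<omega> = id" if "\<omega> \<in> \<Omega> a" for q \<omega>
    using that I J(3) by (simp add: top_def single_apply)
  have top_b: "top q b \<omega> = q" if "\<omega> \<in> \<Omega> b" for q \<omega>
    using that \<Omega>b I by (simp add: top_def single_apply)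
  have swap: "single a \<omega> p \<otimes>\<^bsub>GW\<^esub> top q = top q \<otimes>\<^bsub>GW\<^esub> single a (move (top q) a \<omega>) p"
    if "\<omega> \<in> \<Omega> a" "p permutes \<Delta> a" "q permutes \<Delta> b" for \<omega> p q
    using single_conj[OF J(1,2) anb top_U(2)[OF that(3)] that(1,2)] top_a[OF that(1)] by simp
  have from_point: "U {a, b} \<subseteq> H"
    if H: "subgroup H GW" "H \<subseteq> U (insert a {b})" and top_H: "\<And>q. q permutes \<Delta> b \<Longrightarrow> top q \<in> H"
      and \<omega>: "\<omega> \<in> \<Omega> a" and all: "\<And>p. p permutes \<Delta> a \<Longrightarrow> single a \<omega> p \<in> H" for H \<omega>
  proof (rule layer_from_point[OF J(1,2) anb H _ \<omega> all])
    show "U {b} \<subseteq> proj {b} ` H"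
    proof
      fix f assume f: "f \<in> U {b}"
      have "f b u permutes \<Delta> b" using value_permutes[OF U_carrier[OF f] I(2)] \<Omega>b by simp
      then have "f \<in> H" using top_H U_top[OF f] by metis
      then show "f \<in> proj {b} ` H" using proj_U[OF f] by (metis image_eqI)
    qed
  qed
  have from_two_elements: ?thesis
    if "x \<in> U (insert a {b})" "y \<in> U (insert a {b})"
      and gen: "\<And>H. \<lbrakk>subgroup H GW; H \<subseteq> U (insert a {b}); x \<in> H; y \<in> H\<rbrakk> \<Longrightarrow> U {a, b} \<subseteq> H" for x y
  proof -
    have S: "{x, y} \<subseteq> U (insert a {b})" using that(1,2) by simp
    have "U {a, b} \<subseteq> generate GW {x, y}"
    proof (rule gen)
      show "subgroup (generate GW {x, y}) GW"
        using S U_carrier by (intro generate_is_subgroup) blast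
      show "generate GW {x, y} \<subseteq> U (insert a {b})" by (rule generate_subgroup_incl[OF S sub])
    qed (auto intro: generate.incl)
    then show ?thesis
      unfolding generated_by_at_most_def using S
      by (intro exI[of _ "{x, y}"]) (simp add: card_insert_if)
  qed
  obtain a1 b1 s1 L1 where ab1: "a1 \<in> \<Delta> a" "b1 \<in> \<Delta> a" and s1: "s1 permutes \<Delta> a"
    and L1: "odd L1" "s1 ^^ L1 = id"
    and gen1: "Sym_from_conjugates (\<Delta> a) a1 b1 s1"
    by (rule odd_order_and_transposition_generate[OF finite_\<Delta>[OF I(1)] card_\<Delta>[OF I(1)]]) blast
  let ?t1 = "transpose a1 b1"
  have t1: "?t1 permutes \<Delta> a" using ab1 by (simp add: permutes_swap_id)
  have top_sq: "top (transpose x y) \<otimes>\<^bsub>GW\<^esub> top (transpose x y) = \<one>\<^bsub>GW\<^esub>"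
    if "x \<in> \<Delta> b" "y \<in> \<Delta> b" for x y
    using that top_mult[of "transpose x y" "transpose x y"]
    by (simp add: permutes_swap_id top_def single_id)
  have pow1: "single a \<omega> s1 [^]\<^bsub>GW\<^esub> L1 = \<one>\<^bsub>GW\<^esub>" for \<omega>
    using s1 L1(2) by (simp add: single_pow single_id)
  consider (antichain) "up a = {}" | (two) "card (\<Delta> b) = 2" | (chain) "up a = {b}" "3 \<le> card (\<Delta> b)"
    using upa card_\<Delta>[OF I(2)] by fastforce
  then show ?thesis
  proof cases
    case two
    then obtain x y where xy: "\<Delta> b = {x, y}" by (auto simp: card_2_iff)
    have tr: "transpose x y permutes \<Delta> b" using xy by (simp add: permutes_swap_id)
    have "U {b} \<subseteq> generate GW {top (transpose x y)}"
    proof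
      fix f assume f: "f \<in> U {b}"
      have "f b u permutes \<Delta> b" using value_permutes[OF U_carrier[OF f] I(2)] \<Omega>b by simp
      then have "f b u = id \<or> f b u = transpose x y" using xy by (simp add: permutes_doubleton_iff)
      then show "f \<in> generate GW {top (transpose x y)}"
        using U_top[OF f] generate.one[of GW] by (auto simp: top_def single_id intro: generate.incl)
    qed
    then have "generated_by_at_most 1 {b}"
      unfolding generated_by_at_most_def using top_U(1)[OF tr]
      by (intro exI[of _ "{top (transpose x y)}"]) simp
    then show ?thesis using generated_insert[OF J(1,2) anb] by (simp add: numeral_2_eq_2)
  next
    case antichain
    have \<Omega>a: "\<Omega> a = {u}" by (simp add: antichain u_def)
    then have ua: "u \<in> \<Omega> a" by simp
    obtain a2 b2 s2 L2 where ab2: "a2 \<in> \<Delta> b" "b2 \<in> \<Delta> b" and s2: "s2 permutes \<Delta> b"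
      and L2: "odd L2" "s2 ^^ L2 = id"
      and gen2: "Sym_from_conjugates (\<Delta> b) a2 b2 s2"
      by (rule odd_order_and_transposition_generate[OF finite_\<Delta>[OF I(2)] card_\<Delta>[OF I(2)]]) blast
    let ?t2 = "transpose a2 b2"
    have t2: "?t2 permutes \<Delta> b" using ab2 by (simp add: permutes_swap_id)
    have comm: "single a u p \<otimes>\<^bsub>GW\<^esub> top q = top q \<otimes>\<^bsub>GW\<^esub> single a u p"
      if "p permutes \<Delta> a" "q permutes \<Delta> b" for p q
      using swap[OF ua that] move_in[OF top_U(3)[OF that(2)] ua] \<Omega>a by simp
    have sq1: "single a u ?t1 \<otimes>\<^bsub>GW\<^esub> single a u ?t1 = \<one>\<^bsub>GW\<^esub>"
      using t1 by (simp add: single_mult single_id)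
    have pow2: "top s2 [^]\<^bsub>GW\<^esub> L2 = \<one>\<^bsub>GW\<^esub>"
      unfolding top_def using s2 L2(2) by (simp add: single_pow single_id)
    show ?thesis
    proof (rule from_two_elements)
      show "single a u ?t1 \<otimes>\<^bsub>GW\<^esub> top s2 \<in> U (insert a {b})" "top ?t2 \<otimes>\<^bsub>GW\<^esub> single a u s1 \<in> U (insert a {b})"
        using sU t1 s1 t2 s2 top_U by (simp_all add: subgroup.m_closed[OF sub])
      fix H assume H: "subgroup H GW" "H \<subseteq> U (insert a {b})"
        and xH: "single a u ?t1 \<otimes>\<^bsub>GW\<^esub> top s2 \<in> H" and yH: "top ?t2 \<otimes>\<^bsub>GW\<^esub> single a u s1 \<in> H"
      have 1: "single a u ?t1 \<in> H" "top s2 \<in> H"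
        using factors_of_commuting_product[OF H(1) sU(2)[OF t1] top_U(3)[OF s2] comm[OF t1 s2] sq1 pow2 L2(1) xH]
        by auto
      have 2: "top ?t2 \<in> H" "single a u s1 \<in> H"
        using factors_of_commuting_product[OF H(1) top_U(3)[OF t2] sU(2)[OF s1] comm[OF s1 t2, symmetric]
          top_sq[OF ab2] pow1 L1(1) yH] by auto
      show "U {a, b} \<subseteq> H"
      proof (rule from_point[OF H _ ua])
        show "top q \<in> H" if "q permutes \<Delta> b" for q
          unfolding top_def using 1(2) 2(1) unfolding top_def
          by (intro point_generated[OF H(1) I(2) ub ab2 gen2 s2 _ _ that])
        show "single a u p \<in> H" if "p permutes \<Delta> a" for p
          using 1(1) 2(2) by (intro point_generated[OF H(1) I(1) ua ab1 gen1 s1 _ _ that])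
      qed
    qed
  next
    case chain
    define pt where "pt x = (\<lambda>j\<in>{b}. x)" for x :: 'a
    have pt: "pt x \<in> \<Omega> a" if "x \<in> \<Delta> b" for x using that chain(1) by (simp add: pt_def)
    have move_top: "move (top q) a (pt x) = pt (q x)" for q x
      unfolding gwr_act_def chain(1) pt_def
      by (rule restrict_ext) (use top_b \<Omega>b upb in \<open>simp add: u_def restrict_def\<close>)
    obtain xs where xs: "set xs = \<Delta> b" "distinct xs" using finite_distinct_list[OF finite_\<Delta>[OF I(2)]] by blast
    have len: "3 \<le> length xs" using chain(2) distinct_card[OF xs(2)] xs(1) by simp
    have nth_\<Delta>: "j < length xs \<Longrightarrow> xs ! j \<in> \<Delta> b" for j using xs(1) nth_mem by blast
    have nth_neq: "j < length xs \<Longrightarrow> k < length xs \<Longrightarrow> j \<noteq> k \<Longrightarrow> xs ! j \<noteq> xs ! k" for j k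
      using nth_eq_iff_index_eq[OF xs(2)] by blast
    have x012: "xs ! 0 \<in> \<Delta> b" "xs ! 1 \<in> \<Delta> b" "xs ! 2 \<in> \<Delta> b" using len by (auto intro!: nth_\<Delta>)
    have adj_perm: "transpose (xs ! j) (xs ! Suc j) permutes \<Delta> b" if "Suc j < length xs" for j
      using that nth_\<Delta> by (simp add: permutes_swap_id)
    define \<sigma> where "\<sigma> = cycle_of_list xs"
    have \<sigma>: "\<sigma> permutes \<Delta> b" unfolding \<sigma>_def using cycle_permutes xs(1) by metis
    have \<sigma>_nth: "\<sigma> (xs ! j) = xs ! Suc j" if "Suc j < length xs" for j
      using cycle_of_list_nth[OF xs(2), of j] that by (simp add: \<sigma>_def)
    define c where "c = single a (pt (xs ! 0)) ?t1"
    define d where "d = single a (pt (xs ! 2)) s1"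
    define \<tau> where "\<tau> = transpose (xs ! 0) (xs ! 1)"
    have \<tau>: "\<tau> permutes \<Delta> b" unfolding \<tau>_def using x012 by (simp add: permutes_swap_id)
    have cW: "c \<in> carrier GW" "c \<in> U (insert a {b})" unfolding c_def using sU[OF t1] by auto
    have dW: "d \<in> carrier GW" "d \<in> U (insert a {b})" unfolding d_def using sU[OF s1] by auto
    have \<tau>2: "\<tau> (xs ! 2) = xs ! 2"
      unfolding \<tau>_def by (rule transpose_apply_other; rule nth_neq; use len in linarith)
    have comm_d: "top \<tau> \<otimes>\<^bsub>GW\<^esub> d = d \<otimes>\<^bsub>GW\<^esub> top \<tau>"
      unfolding d_def using swap[OF pt[OF x012(3)] s1 \<tau>] by (simp add: move_top \<tau>2)
    have comm_c: "top q \<otimes>\<^bsub>GW\<^esub> c = c \<otimes>\<^bsub>GW\<^esub> top q" if "q permutes \<Delta> b" "q (xs ! 0) = xs ! 0" for q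
      unfolding c_def using swap[OF pt[OF x012(1)] t1 that(1)] by (simp add: move_top that(2))
    define x where "x = top \<sigma> \<otimes>\<^bsub>GW\<^esub> c"
    have xW: "x \<in> carrier GW" "x \<in> U (insert a {b})"
      unfolding x_def using cW top_U[OF \<sigma>] by (simp_all add: subgroup.m_closed[OF sub])
    show ?thesis
    proof (rule from_two_elements)
      show "x \<in> U (insert a {b})" "top \<tau> \<otimes>\<^bsub>GW\<^esub> d \<in> U (insert a {b})"
        using xW dW top_U[OF \<tau>] by (simp_all add: subgroup.m_closed[OF sub])
      fix H assume H: "subgroup H GW" "H \<subseteq> U (insert a {b})" and xH: "x \<in> H" and yH: "top \<tau> \<otimes>\<^bsub>GW\<^esub> d \<in> H"
      have pow_d: "d [^]\<^bsub>GW\<^esub> L1 = \<one>\<^bsub>GW\<^esub>" unfolding d_def by (rule pow1)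
      have sq: "top \<tau> \<otimes>\<^bsub>GW\<^esub> top \<tau> = \<one>\<^bsub>GW\<^esub>" unfolding \<tau>_def using x012 by (intro top_sq)
      note parts = factors_of_commuting_product[OF H(1) top_U(3)[OF \<tau>] dW(1) comm_d sq pow_d L1(1) yH]
      \<comment> \<open>The transpositions obtained by repeated conjugation with \<open>x\<close> all fix the first point, where
        \<open>c\<close> is placed, so that \<open>c\<close> does not disturb them until the path through all points is complete.\<close>
      have adj_H: "Suc j < length xs \<Longrightarrow> top (transpose (xs ! j) (xs ! Suc j)) \<in> H" for j
      proof (induction j)
        case 0
        then show ?case using parts(1) by (simp add: \<tau>_def)
      next
        case (Suc j)
        let ?p = "transpose (xs ! j) (xs ! Suc j)" and ?q = "transpose (xs ! Suc j) (xs ! Suc (Suc j))"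
        have p: "?p permutes \<Delta> b" and q: "?q permutes \<Delta> b" using Suc.prems adj_perm by auto
        have "?q = \<sigma> \<circ> ?p \<circ> Hilbert_Choice.inv \<sigma>"
          using conj_transpose[OF permutes_bij[OF \<sigma>], of "xs ! j" "xs ! Suc j"] \<sigma>_nth Suc.prems by simp
        then have eq: "\<sigma> \<circ> ?p = ?q \<circ> \<sigma>" using permutes_inv_o(2)[OF \<sigma>] by (simp add: comp_assoc)
        have q0: "?q (xs ! 0) = xs ! 0"
          by (rule transpose_apply_other; rule nth_neq; use Suc.prems in linarith)
        have "top ?p \<otimes>\<^bsub>GW\<^esub> x = top (\<sigma> \<circ> ?p) \<otimes>\<^bsub>GW\<^esub> c"
          unfolding x_def using top_U(3)[OF p] top_U(3)[OF \<sigma>] cW by (simp add: top_mult[OF p \<sigma>] flip: m_assoc)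
        also have "\<dots> = top \<sigma> \<otimes>\<^bsub>GW\<^esub> (top ?q \<otimes>\<^bsub>GW\<^esub> c)"
          unfolding eq using top_U(3)[OF q] top_U(3)[OF \<sigma>] cW by (simp add: top_mult[OF \<sigma> q] flip: m_assoc)
        also have "\<dots> = x \<otimes>\<^bsub>GW\<^esub> top ?q"
          unfolding x_def comm_c[OF q q0] using top_U(3)[OF q] top_U(3)[OF \<sigma>] cW by (simp add: m_assoc)
        finally have "top ?q = inv\<^bsub>GW\<^esub> x \<otimes>\<^bsub>GW\<^esub> (top ?p \<otimes>\<^bsub>GW\<^esub> x)"
          using xW(1) top_U(3)[OF q] by (simp flip: m_assoc)
        moreover have "top ?p \<in> H" using Suc by simp
        ultimately show ?case
          using xH by (simp add: subgroup.m_closed[OF H(1)] subgroup.m_inv_closed[OF H(1)])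
      qed
      have top_H: "top q \<in> H" if q: "q permutes \<Delta> b" for q
      proof -
        have "q \<in> {q. q permutes \<Delta> b \<and> top q \<in> H}"
        proof (rule adjacent_transpositions_generate[OF _ _ _ xs(2)])
          show "id \<in> {q. q permutes \<Delta> b \<and> top q \<in> H}"
            using subgroup.one_closed[OF H(1)] by (simp add: top_def single_id permutes_id)
          show "q permutes set xs" using q xs(1) by simp
        qed (use single_comp_closed[OF H(1)] adj_H adj_perm in \<open>auto simp: top_def intro: permutes_compose\<close>)
        then show ?thesis by simp
      qed
      have "c = inv\<^bsub>GW\<^esub> (top \<sigma>) \<otimes>\<^bsub>GW\<^esub> x"
        unfolding x_def using cW(1) top_U(3)[OF \<sigma>] by (simp flip: m_assoc)
      then have cH: "c \<in> H"
        using xH top_H[OF \<sigma>] by (simp add: subgroup.m_closed[OF H(1)] subgroup.m_inv_closed[OF H(1)])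
      have tr: "transpose (xs ! 0) (xs ! 2) permutes \<Delta> b" using x012 by (simp add: permutes_swap_id)
      \<comment> \<open>The odd-order element is at the third point, so the transposition is moved there.\<close>
      have t2: "single a (pt (xs ! 2)) ?t1 \<in> H"
        using single_conj_closed[OF J(1,2) anb H(1) top_H[OF tr] top_U(2)[OF tr] pt[OF x012(1)] t1 cH[unfolded c_def]]
        by (simp add: move_top top_a[OF pt[OF x012(1)]])
      have s2: "single a (pt (xs ! 2)) s1 \<in> H" using parts(2) by (simp add: d_def)
      show "U {a, b} \<subseteq> H"
      proof (rule from_point[OF H _ pt[OF x012(3)]])
        show "single a (pt (xs ! 2)) p \<in> H" if "p permutes \<Delta> a" for p
          by (intro point_generated[OF H(1) I(1) pt[OF x012(3)] ab1 gen1 s1 s2 t2 that])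
      qed (rule top_H)
    qed
  qed
qed

section \<open>Induction over ancestral sets\<close>

lemma ex_minimal_index:
  assumes K: "ancestral I r K" "K \<noteq> {}"
  obtains i where "i \<in> K" "ancestral I r (K - {i})"
proof -
  have fin: "finite K" using ancestral_subset[OF K(1)] finite_I finite_subset by blast
  \<comment> \<open>An index with as many indices above it as possible has none of \<open>K\<close> below it.\<close>
  let ?M = "Max ((\<lambda>i. card (up i)) ` K)"
  obtain i where i: "i \<in> K" "card (up i) = ?M"
    using Max_in[of "(\<lambda>i. card (up i)) ` K"] fin K(2) by (metis (no_types, lifting) finite_imageI image_iff image_is_empty)
  have max: "card (up j) \<le> card (up i)" if "j \<in> K" for j
    using that fin i(2) by simp
  have "i \<notin> up j" if j: "j \<in> K" for j
  proof
    assume ij: "i \<in> up j"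
    then have "up i \<subset> up j" using above_trans[OF po ij] ij not_in_up by blast
    moreover have "finite (up j)" using finite_I by (simp add: above_def)
    ultimately have "card (up i) < card (up j)" by (intro psubset_card_mono)
    then show False using max[OF j] by simp
  qed
  then have "ancestral I r (K - {i})" using K(1) by (auto simp: ancestral_def)
  then show thesis using i that by blast
qed

lemma generated_ancestral:
  assumes "ancestral I r K" "2 \<le> card K"
  shows "generated_by_at_most (card K) K"
  using assms
proof (induction "card K" arbitrary: K rule: less_induct)
  case less
  have fin: "finite K" using ancestral_subset[OF less.prems(1)] finite_I finite_subset by blast
  have "K \<noteq> {}" using less.prems(2) by auto
  then obtain i where i: "i \<in> K" and anc: "ancestral I r (K - {i})"
    by (rule ex_minimal_index[OF less.prems(1)])
  have ins: "insert i (K - {i}) = K" using i by blast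
  have card: "card K = Suc (card (K - {i}))" by (rule card.remove[OF fin i])
  show ?case
  proof (cases "card K = 2")
    case True
    then obtain b where b: "K - {i} = {b}" using card by (auto simp: card_1_singleton_iff)
    then show ?thesis
      using generated_pair[of b i] anc ins less.prems(1) True i by (metis Diff_iff singletonI)
  next
    case False
    then have "generated_by_at_most (card (K - {i})) (K - {i})"
      using less.hyps[OF _ anc] less.prems(2) card by simp
    then show ?thesis
      using generated_insert[of "K - {i}" i] anc ins less.prems(1) card by simp
  qed
qed

section \<open>The sign characters\<close>

definition layer_sign :: "'i \<Rightarrow> ('i \<Rightarrow> ('i \<Rightarrow> 'a) \<Rightarrow> 'a \<Rightarrow> 'a) \<Rightarrow> int" where
  "layer_sign i f = (\<Prod>\<omega>\<in>\<Omega> i. sign (f i \<omega>))"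

lemma value_permutation:
  "f \<in> carrier GW \<Longrightarrow> i \<in> I \<Longrightarrow> \<omega> \<in> \<Omega> i \<Longrightarrow> permutation (f i \<omega>)"
  by (rule permutes_imp_permutation[OF finite_\<Delta> value_permutes])

text \<open>
  The first factor permutes \<open>\<Omega> i\<close> before the second is evaluated; this only reorders the product.
\<close>

lemma layer_sign_mult:
  assumes i: "i \<in> I" and f: "f \<in> carrier GW" and h: "h \<in> carrier GW"
  shows "layer_sign i (f \<otimes>\<^bsub>GW\<^esub> h) = layer_sign i f * layer_sign i h"
proof -
  have "move f i ` \<Omega> i \<subseteq> \<Omega> i" using move_in[OF f] by blast
  then have bij: "bij_betw (move f i) (\<Omega> i) (\<Omega> i)"
    using inj_on_move[OF f] endo_inj_surj[OF finite_\<Omega>] unfolding bij_betw_def by blast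
  have "layer_sign i (f \<otimes>\<^bsub>GW\<^esub> h) = (\<Prod>\<omega>\<in>\<Omega> i. sign (h i (move f i \<omega>)) * sign (f i \<omega>))"
    unfolding layer_sign_def
    using f h i move_in[OF f] by (intro prod.cong) (auto simp: mult_apply sign_compose value_permutation)
  also have "\<dots> = (\<Prod>\<omega>\<in>\<Omega> i. sign (h i (move f i \<omega>))) * layer_sign i f"
    by (simp add: prod.distrib layer_sign_def)
  also have "(\<Prod>\<omega>\<in>\<Omega> i. sign (h i (move f i \<omega>))) = layer_sign i h"
    unfolding layer_sign_def using prod.reindex_bij_betw[OF bij, of "\<lambda>\<omega>. sign (h i \<omega>)"] .
  finally show ?thesis by simp
qed

lemma layer_sign_square: "layer_sign i f * layer_sign i f = 1"
  by (simp add: layer_sign_def flip: prod.distrib)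

lemma layer_sign_one: "i \<in> I \<Longrightarrow> layer_sign i \<one>\<^bsub>GW\<^esub> = 1"
  by (simp add: layer_sign_def one_apply)

lemma layer_sign_inv:
  assumes "i \<in> I" "f \<in> carrier GW"
  shows "layer_sign i (inv\<^bsub>GW\<^esub> f) = layer_sign i f"
proof -
  have "layer_sign i (inv\<^bsub>GW\<^esub> f) * layer_sign i f = layer_sign i f * layer_sign i f"
    using layer_sign_mult[OF assms(1) inv_closed[OF assms(2)] assms(2)] assms
    by (simp add: layer_sign_one layer_sign_square)
  then show ?thesis using layer_sign_square[of i f] by (metis mult_cancel_right mult_zero_left zero_neq_one)
qed

lemma layer_signs_surj:
  assumes v: "v \<in> PiE I (\<lambda>_. {1, -1})"
  shows "v \<in> (\<lambda>f. \<lambda>i\<in>I. layer_sign i f) ` carrier GW"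
proof -
  have "\<exists>x y. x \<in> \<Delta> i \<and> y \<in> \<Delta> i \<and> x \<noteq> y" if "i \<in> I" for i
    using card_\<Delta>[OF that] card_le_Suc0_iff_eq[OF finite_\<Delta>[OF that]] by fastforce
  then obtain x y where xy: "\<And>i. i \<in> I \<Longrightarrow> x i \<in> \<Delta> i \<and> y i \<in> \<Delta> i \<and> x i \<noteq> y i" by metis
  have point: "(\<lambda>j\<in>up i. x j) \<in> \<Omega> i" for i using xy by (auto simp: above_def)
  define f where "f = tabulate (\<lambda>i \<omega>. if \<omega> = (\<lambda>j\<in>up i. x j) \<and> v i = -1 then transpose (x i) (y i) else id)"
  have "f \<in> carrier GW"
    unfolding f_def using xy by (intro tabulate_in) (auto intro: permutes_swap_id permutes_id)
  moreover have "layer_sign i f = v i" if i: "i \<in> I" for i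
  proof -
    have "layer_sign i f = (\<Prod>\<omega>\<in>\<Omega> i. if \<omega> = (\<lambda>j\<in>up i. x j) then v i else 1)"
      unfolding layer_sign_def f_def
      using i xy[OF i] PiE_mem[OF v i] by (intro prod.cong) (auto simp: sign_swap_id)
    also have "\<dots> = v i" using point finite_\<Omega> by (simp add: prod.delta)
    finally show ?thesis .
  qed
  then have "(\<lambda>i\<in>I. layer_sign i f) = v" using v by (intro PiE_ext[of _ I "\<lambda>_. UNIV"]) auto
  ultimately show ?thesis by (metis image_eqI)
qed

text \<open>
  In an elementary abelian 2-group, every element generated by a finite set is the product over one
  of its subsets, and products of such are products over symmetric differences. The sign vectors form
  such a group of order \<open>2 ^ card I\<close>, so that \<open>2 ^ card I \<le> 2 ^ card S\<close>.
\<close>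

lemma card_le_generators:
  assumes S: "S \<subseteq> carrier GW" "finite S" "generate GW S = carrier GW"
  shows "card I \<le> card S"
proof -
  define \<chi> where "\<chi> T = (\<lambda>i\<in>I. \<Prod>x\<in>T. layer_sign i x)" for T
  have "\<exists>T\<subseteq>S. \<forall>i\<in>I. layer_sign i f = (\<Prod>x\<in>T. layer_sign i x)" if "f \<in> generate GW S" for f
    using that
  proof (induction rule: generate.induct)
    case one
    then show ?case by (intro exI[of _ "{}"]) (simp add: layer_sign_one)
  next
    case (incl h)
    then show ?case by (intro exI[of _ "{h}"]) simp
  next
    case (inv h)
    then show ?case using S(1) by (intro exI[of _ "{h}"]) (auto simp: layer_sign_inv)
  next
    case (eng f h)
    obtain A B where A: "A \<subseteq> S" "\<And>i. i \<in> I \<Longrightarrow> layer_sign i f = (\<Prod>x\<in>A. layer_sign i x)"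
      and B: "B \<subseteq> S" "\<And>i. i \<in> I \<Longrightarrow> layer_sign i h = (\<Prod>x\<in>B. layer_sign i x)"
      using eng.IH by blast
    have fin: "finite A" "finite B" using A(1) B(1) S(2) finite_subset by blast+
    have fh: "f \<in> carrier GW" "h \<in> carrier GW" using eng.hyps S(3) by auto
    have "layer_sign i (f \<otimes>\<^bsub>GW\<^esub> h) = (\<Prod>x\<in>(A - B) \<union> (B - A). layer_sign i x)" if i: "i \<in> I" for i
    proof -
      let ?p = "\<lambda>T. \<Prod>x\<in>T. layer_sign i x"
      have "?p A = ?p (A - B) * ?p (A \<inter> B)" "?p B = ?p (B - A) * ?p (A \<inter> B)"
        using prod.Int_Diff[OF fin(1), of _ B] prod.Int_Diff[OF fin(2), of _ A]
        by (simp_all add: Int_commute mult.commute)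
      moreover have "?p (A \<inter> B) * ?p (A \<inter> B) = 1"
        by (simp add: layer_sign_square flip: prod.distrib)
      moreover have "?p ((A - B) \<union> (B - A)) = ?p (A - B) * ?p (B - A)"
        using fin by (intro prod.union_disjoint) auto
      ultimately show ?thesis
        using layer_sign_mult[OF i fh] A(2)[OF i] B(2)[OF i] by (simp add: algebra_simps)
    qed
    then show ?case using A(1) B(1) by (intro exI[of _ "(A - B) \<union> (B - A)"]) auto
  qed
  then have "\<exists>T\<in>Pow S. (\<lambda>i\<in>I. layer_sign i f) = \<chi> T" if "f \<in> carrier GW" for f
    using that unfolding S(3) \<chi>_def by (metis (mono_tags, lifting) PowI restrict_ext)
  then have "(\<lambda>f. \<lambda>i\<in>I. layer_sign i f) ` carrier GW \<subseteq> \<chi> ` Pow S" by blast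
  then have "PiE I (\<lambda>_. {1, -1 :: int}) \<subseteq> \<chi> ` Pow S" using layer_signs_surj by blast
  then have "card (PiE I (\<lambda>_. {1, -1 :: int})) \<le> card (Pow S)"
    using S(2) by (meson card_image_le card_mono finite_Pow_iff finite_imageI order_trans)
  then have "(2::nat) ^ card I \<le> 2 ^ card S"
    using finite_I S(2) by (simp add: card_PiE card_Pow numeral_2_eq_2)
  then show ?thesis by simp
qed

end

theorem theorem1p1:
  fixes I :: "'i set" and r :: "'i rel" and \<Delta> :: "'i \<Rightarrow> 'a set"
  assumes "finite I" and "partial_order_on I r" and "card I \<ge> 2"
    and "\<And>i. i \<in> I \<Longrightarrow> finite (\<Delta> i) \<and> card (\<Delta> i) \<ge> 2"
  shows "min_generators (generalised_wreath_product I r \<Delta> (\<lambda>i. Sym_on (\<Delta> i))) = enat (card I)"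
proof -
  interpret symmetric_gwr I r \<Delta> by standard (use assms in auto)
  obtain S where S: "S \<subseteq> carrier GW" "finite S" "card S \<le> card I" "carrier GW \<subseteq> generate GW S"
    using generated_ancestral[OF ancestral_carrier assms(3)]
    unfolding generated_by_at_most_def U_I by blast
  have gen: "generate GW S = carrier GW" using S(4) generate_incl[OF S(1)] by blast
  show ?thesis
    unfolding min_generators_def
  proof (rule antisym)
    show "(INF S\<in>{S. S \<subseteq> carrier GW \<and> finite S \<and> generate GW S = carrier GW}. enat (card S)) \<le> enat (card I)"
      using S gen by (intro INF_lower2[of S]) auto
    show "enat (card I) \<le> (INF S\<in>{S. S \<subseteq> carrier GW \<and> finite S \<and> generate GW S = carrier GW}. enat (card S))"
      using card_le_generators by (intro INF_greatest) simp
  qed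
qed

end
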